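(* For every integer $n\ge 0$, $$|AI_{2n+1}(1243)|=|AI_{2n+1}(2143)|=|RAI_{2n+1}(2143)|=|RAI_{2n+1}(2134)|=M_n,$$ where $M_n$ is the $n$-th Motzkin number.
   Context: Let $S_n$ be the set of permutations $\pi=\pi_1\ldots\pi_n$ of $\{1,\ldots,n\}$. A permutation is alternating if, for all $1\le i\le n-1$, $\pi_i<\pi_{i+1}$ if and only if $i$ is odd; it is reverse alternating if, for all $1\le i\le n-1$, $\pi_i>\pi_{i+1}$ if and only if $i$ is odd. $AI_n$ (resp. $RAI_n$) is the set of alternating (resp. reverse alternating) involutions ($\pi=\pi^{-1}$) in $S_n$. A permutation $\pi\in S_n$ avoids the pattern $\tau\in S_k$ if there are no indices $i_1<\cdots<i_k$ such that $\pi_{i_1}\ldots\pi_{i_k}$ is order-isomorphic to $\tau$; $AI_n(\tau)$ and $RAI_n(\tau)$ are the subsets of elements avoiding $\tau$. The Motzkin number $M_n$ is the number of Motzkin paths of length $n$, i.e. lattice paths from $(0,0)$ to $(n,0)$ with steps $U=(1,1)$, $D=(1,-1)$, $H=(1,0)$ that stay weakly above the $x$-axis (so $M_0=M_1=1$, $M_2=2$, $M_3=4$). *)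

theory Defs
  imports "HOL-Combinatorics.Permutations"
begin

text \<open>
  A permutation in \<open>S\<^sub>n\<close> is a function that permutes \<open>{1..n}\<close>, with \<open>\<pi> i\<close> for \<open>\<pi>\<^sub>i\<close>. By the
  definition of \<^const>\<open>permutes\<close> it is the identity outside \<open>{1..n}\<close>, so sets of permutations of
  \<open>{1..n}\<close> are finite and their cardinalities are the intended ones.
\<close>

definition alternating :: "nat \<Rightarrow> (nat \<Rightarrow> nat) \<Rightarrow> bool" where
  "alternating n \<pi> \<longleftrightarrow> (\<forall>i. 1 \<le> i \<and> i + 1 \<le> n \<longrightarrow> (\<pi> i < \<pi> (i + 1) \<longleftrightarrow> odd i))"

definition reverse_alternating :: "nat \<Rightarrow> (nat \<Rightarrow> nat) \<Rightarrow> bool" where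
  "reverse_alternating n \<pi> \<longleftrightarrow> (\<forall>i. 1 \<le> i \<and> i + 1 \<le> n \<longrightarrow> (\<pi> i > \<pi> (i + 1) \<longleftrightarrow> odd i))"

text \<open>
  A pattern is given in one-line notation, as the list of its values. The positions of the list
  are counted from 0, the positions of \<open>\<pi>\<close> from 1.
\<close>

definition contains_pattern :: "nat \<Rightarrow> (nat \<Rightarrow> nat) \<Rightarrow> nat list \<Rightarrow> bool" where
  "contains_pattern n \<pi> \<tau> \<longleftrightarrow>
    (\<exists>idx :: nat \<Rightarrow> nat.
       strict_mono_on {..<length \<tau>} idx \<and> idx ` {..<length \<tau>} \<subseteq> {1..n} \<and>
       (\<forall>a<length \<tau>. \<forall>b<length \<tau>. \<pi> (idx a) < \<pi> (idx b) \<longleftrightarrow> \<tau> ! a < \<tau> ! b))"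

definition AI :: "nat \<Rightarrow> (nat \<Rightarrow> nat) set" where
  "AI n = {\<pi>. \<pi> permutes {1..n} \<and> \<pi> = inv \<pi> \<and> alternating n \<pi>}"

definition RAI :: "nat \<Rightarrow> (nat \<Rightarrow> nat) set" where
  "RAI n = {\<pi>. \<pi> permutes {1..n} \<and> \<pi> = inv \<pi> \<and> reverse_alternating n \<pi>}"

definition AI_av :: "nat \<Rightarrow> nat list \<Rightarrow> (nat \<Rightarrow> nat) set" where
  "AI_av n \<tau> = {\<pi> \<in> AI n. \<not> contains_pattern n \<pi> \<tau>}"

definition RAI_av :: "nat \<Rightarrow> nat list \<Rightarrow> (nat \<Rightarrow> nat) set" where
  "RAI_av n \<tau> = {\<pi> \<in> RAI n. \<not> contains_pattern n \<pi> \<tau>}"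

datatype step = Up | Down | Horiz

fun rise :: "step \<Rightarrow> int" where
  "rise Up = 1"
| "rise Down = - 1"
| "rise Horiz = 0"

text \<open>
  Every step advances the abscissa by 1, so a path from \<open>(0,0)\<close> is determined by its steps, its
  length is its final abscissa, and \<open>height p k\<close> is its ordinate at abscissa \<open>k\<close>.
\<close>

definition height :: "step list \<Rightarrow> nat \<Rightarrow> int" where
  "height p k = (\<Sum>s\<leftarrow>take k p. rise s)"

definition motzkin_paths :: "nat \<Rightarrow> step list set" where
  "motzkin_paths n = {p. length p = n \<and> (\<forall>k\<le>n. height p k \<ge> 0) \<and> height p n = 0}"

definition motzkin :: "nat \<Rightarrow> nat" where
  "motzkin n = card (motzkin_paths n)"

end

theory Submission
  imports Defs
begin

text \<open>
  Reverse-complement exchanges alternating and reverse alternating permutations of odd length, so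
  it suffices to compare 1243 with 2143 and to count the reverse alternating involutions avoiding
  2134.

  For a pattern \<open>12\<tau>\<close> or \<open>21\<tau>\<close>, the cells with an occurrence of \<open>\<tau>\<close> to their upper right form a
  Young diagram. Given the dots outside it, the dots inside can be arranged in exactly one way
  without a pair 12 and in exactly one way without a pair 21; uniqueness makes the exchange of the
  two arrangements compatible with inversion. Peaks of an alternating permutation lie outside the
  diagram, so alternation is kept.

  A reverse alternating involution of odd length \<open>N \<ge> 3\<close> avoiding 2134 contains the cycle
  \<open>(1, N - 1)\<close>. Removing it leaves an involution of length \<open>2 * m + 1\<close>, where \<open>N = 2 * m + 3\<close>, that
  is alternating except possibly at the last place, and there 2134 can be exchanged for 1234. The
  Robinson-Schensted correspondence turns these involutions into ballot words with at most three
  columns, in which each pair of consecutive letters adds two boxes in different columns. Pairs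
  thus amount to a choice of the omitted column, and a suitable weighting of the shapes translates
  the steps into those of Motzkin paths.
\<close>

section \<open>Patterns of length four\<close>

lemma strict_mono_on_4:
  "strict_mono_on {..<4::nat} (idx :: nat \<Rightarrow> nat) \<longleftrightarrow> idx 0 < idx 1 \<and> idx 1 < idx 2 \<and> idx 2 < idx 3"
proof
  assume "strict_mono_on {..<4::nat} idx"
  then show "idx 0 < idx 1 \<and> idx 1 < idx 2 \<and> idx 2 < idx 3"
    by (auto simp: strict_mono_on_def)
next
  assume h: "idx 0 < idx 1 \<and> idx 1 < idx 2 \<and> idx 2 < idx 3"
  show "strict_mono_on {..<4::nat} idx"
  proof (rule strict_mono_onI)
    fix r s :: nat assume "r \<in> {..<4}" "s \<in> {..<4}" "r < s"
    then have "r \<in> {0,1,2,3}" "s \<in> {0,1,2,3}" "r < s" by auto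
    then show "idx r < idx s" using h by auto
  qed
qed

lemma contains_pattern_4:
  "contains_pattern n \<pi> [a, b, c, d] \<longleftrightarrow>
    (\<exists>i j k l. 1 \<le> i \<and> i < j \<and> j < k \<and> k < l \<and> l \<le> n \<and>
      (\<forall>u<4. \<forall>v<4. \<pi> ([i, j, k, l] ! u) < \<pi> ([i, j, k, l] ! v) \<longleftrightarrow> [a, b, c, d] ! u < [a, b, c, d] ! v))"
    (is "?L \<longleftrightarrow> ?R")
proof
  assume ?L
  then obtain idx where s: "strict_mono_on {..<4::nat} idx" and im: "idx ` {..<4} \<subseteq> {1..n}"
    and o: "\<And>u v. u < 4 \<Longrightarrow> v < 4 \<Longrightarrow> \<pi> (idx u) < \<pi> (idx v) \<longleftrightarrow> [a, b, c, d] ! u < [a, b, c, d] ! v"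
    unfolding contains_pattern_def by (auto simp: numeral_eq_Suc)
  have e: "[idx 0, idx 1, idx 2, idx 3] ! u = idx u" if "u < 4" for u
  proof -
    have "u \<in> {0,1,2,3}" using that by auto
    then show ?thesis by auto
  qed
  have "idx 0 \<in> {1..n}" "idx 3 \<in> {1..n}" using im by (simp_all add: image_subset_iff)
  then show ?R
    using s o e unfolding strict_mono_on_4
    by (intro exI[of _ "idx 0"] exI[of _ "idx 1"] exI[of _ "idx 2"] exI[of _ "idx 3"]) auto
next
  assume ?R
  then obtain i j k l where h: "1 \<le> i" "i < j" "j < k" "k < l" "l \<le> n" and
    o: "\<And>u v. u < 4 \<Longrightarrow> v < 4 \<Longrightarrow>
      \<pi> ([i, j, k, l] ! u) < \<pi> ([i, j, k, l] ! v) \<longleftrightarrow> [a, b, c, d] ! u < [a, b, c, d] ! v" by blast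
  have len: "length [a, b, c, d] = 4" by simp
  show ?L unfolding contains_pattern_def len
  proof (intro exI[of _ "(!) [i, j, k, l]"] conjI)
    show "strict_mono_on {..<4} ((!) [i, j, k, l])" using h by (simp add: strict_mono_on_4)
    show "(!) [i, j, k, l] ` {..<4} \<subseteq> {1..n}"
    proof
      fix x assume "x \<in> (!) [i, j, k, l] ` {..<4}"
      then obtain u where u: "u < 4" "x = [i, j, k, l] ! u" by auto
      then have "u \<in> {0,1,2,3}" by auto
      then show "x \<in> {1..n}" using u h by auto
    qed
    show "\<forall>u<4. \<forall>v<4. \<pi> ([i, j, k, l] ! u) < \<pi> ([i, j, k, l] ! v) \<longleftrightarrow> [a, b, c, d] ! u < [a, b, c, d] ! v"
      using o by blast
  qed
qed

lemma all_less_4: "(\<forall>u<4::nat. P u) \<longleftrightarrow> P 0 \<and> P 1 \<and> P 2 \<and> P 3"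
  by (auto simp: less_Suc_eq numeral_eq_Suc)

lemma contains_1243:
  "contains_pattern n \<pi> [1, 2, 4, 3] \<longleftrightarrow>
    (\<exists>i j k l. 1 \<le> i \<and> i < j \<and> j < k \<and> k < l \<and> l \<le> n \<and> \<pi> i < \<pi> j \<and> \<pi> j < \<pi> l \<and> \<pi> l < \<pi> k)"
  unfolding contains_pattern_4 all_less_4 by (intro ex_cong1) auto

lemma contains_2143:
  "contains_pattern n \<pi> [2, 1, 4, 3] \<longleftrightarrow>
    (\<exists>i j k l. 1 \<le> i \<and> i < j \<and> j < k \<and> k < l \<and> l \<le> n \<and> \<pi> j < \<pi> i \<and> \<pi> i < \<pi> l \<and> \<pi> l < \<pi> k)"
  unfolding contains_pattern_4 all_less_4 by (intro ex_cong1) auto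

lemma contains_2134:
  "contains_pattern n \<pi> [2, 1, 3, 4] \<longleftrightarrow>
    (\<exists>i j k l. 1 \<le> i \<and> i < j \<and> j < k \<and> k < l \<and> l \<le> n \<and> \<pi> j < \<pi> i \<and> \<pi> i < \<pi> k \<and> \<pi> k < \<pi> l)"
  unfolding contains_pattern_4 all_less_4 by (intro ex_cong1) auto

lemma contains_1234:
  "contains_pattern n \<pi> [1, 2, 3, 4] \<longleftrightarrow>
    (\<exists>i j k l. 1 \<le> i \<and> i < j \<and> j < k \<and> k < l \<and> l \<le> n \<and> \<pi> i < \<pi> j \<and> \<pi> j < \<pi> k \<and> \<pi> k < \<pi> l)"
  unfolding contains_pattern_4 all_less_4 by (intro ex_cong1) auto

section \<open>Exchanging an initial 12 and an initial 21\<close>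

text \<open>With \<open>R\<close> being \<open><\<close> or \<open>>\<close>, the pairs sought for are the 34 resp. 43 of a pattern of length 4.\<close>

definition upper_right :: "nat \<Rightarrow> (nat \<Rightarrow> nat \<Rightarrow> bool) \<Rightarrow> (nat \<Rightarrow> nat) \<Rightarrow> nat \<Rightarrow> nat \<Rightarrow> bool" where
  "upper_right n R \<pi> c y \<longleftrightarrow> (\<exists>i j. c < i \<and> i < j \<and> j \<le> n \<and> y < \<pi> i \<and> y < \<pi> j \<and> R (\<pi> i) (\<pi> j))"

text \<open>What follows the pair must lie to the right of its later dot \<open>q\<close> and above
  its higher dot, which is \<open>q\<close> itself in an ascending pair and \<open>p\<close> in a
  descending one.\<close>

definition has_asc :: "nat \<Rightarrow> (nat \<Rightarrow> nat \<Rightarrow> bool) \<Rightarrow> (nat \<Rightarrow> nat) \<Rightarrow> bool" where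
  "has_asc n R \<pi> \<longleftrightarrow> (\<exists>p q. 1 \<le> p \<and> p < q \<and> q \<le> n \<and> \<pi> p < \<pi> q \<and> upper_right n R \<pi> q (\<pi> q))"

definition has_desc :: "nat \<Rightarrow> (nat \<Rightarrow> nat \<Rightarrow> bool) \<Rightarrow> (nat \<Rightarrow> nat) \<Rightarrow> bool" where
  "has_desc n R \<pi> \<longleftrightarrow> (\<exists>p q. 1 \<le> p \<and> p < q \<and> q \<le> n \<and> \<pi> q < \<pi> p \<and> upper_right n R \<pi> q (\<pi> p))"

text \<open>A permutation without ascending (or without descending) pair is determined by its frame: the
  cells \<open>(c, y)\<close> of the first component form a Young diagram, and the positions and values of the
  dots inside it are those not used by the dots outside.\<close>

definition frame :: "nat \<Rightarrow> (nat \<Rightarrow> nat \<Rightarrow> bool) \<Rightarrow> (nat \<Rightarrow> nat) \<Rightarrow> (nat \<times> nat) set \<times> (nat \<times> nat) set" where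
  "frame n R \<pi> = ({(c, y). upper_right n R \<pi> c y}, {(i, \<pi> i) | i. i \<in> {1..n} \<and> \<not> upper_right n R \<pi> i (\<pi> i)})"

lemma upper_right_mono: "upper_right n R \<pi> c y \<Longrightarrow> c' \<le> c \<Longrightarrow> y' \<le> y \<Longrightarrow> upper_right n R \<pi> c' y'"
  unfolding upper_right_def by (meson le_less_trans)

text \<open>If a dot of the occurrence found is itself inside the diagram, the search continues from
  that dot, further right and higher up; it ends because \<open>n - c\<close> decreases.\<close>

lemma upper_right_outside:
  assumes "upper_right n R \<pi> c y"
  shows "\<exists>i j. c < i \<and> i < j \<and> j \<le> n \<and> y < \<pi> i \<and> y < \<pi> j \<and> R (\<pi> i) (\<pi> j) \<and>
    \<not> upper_right n R \<pi> i (\<pi> i) \<and> \<not> upper_right n R \<pi> j (\<pi> j)"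
  using assms
proof (induction "n - c" arbitrary: c y rule: less_induct)
  case less
  then obtain i j where ij: "c < i" "i < j" "j \<le> n" "y < \<pi> i" "y < \<pi> j" "R (\<pi> i) (\<pi> j)"
    unfolding upper_right_def by blast
  show ?case
  proof (cases "upper_right n R \<pi> i (\<pi> i) \<or> upper_right n R \<pi> j (\<pi> j)")
    case True
    then obtain k where k: "upper_right n R \<pi> k (\<pi> k)" "k = i \<or> k = j" by blast
    then have "n - k < n - c" "c < k" "y < \<pi> k" using ij by auto
    then show ?thesis using less.hyps[of k "\<pi> k"] k by (meson less_trans)
  next
    case False
    then show ?thesis using ij by blast
  qed
qed

text \<open>An occurrence made of outside dots survives in any \<open>\<pi>'\<close> that keeps
  these dots.\<close>

lemma upper_right_transfer:
  assumes "upper_right n R \<pi> c y"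
    and "\<And>i. \<not> upper_right n R \<pi> i (\<pi> i) \<Longrightarrow> i \<in> {1..n} \<Longrightarrow> \<pi>' i = \<pi> i"
  shows "upper_right n R \<pi>' c y"
proof -
  obtain i j where ij: "c < i" "i < j" "j \<le> n" "y < \<pi> i" "y < \<pi> j" "R (\<pi> i) (\<pi> j)"
    "\<not> upper_right n R \<pi> i (\<pi> i)" "\<not> upper_right n R \<pi> j (\<pi> j)"
    using upper_right_outside[OF assms(1)] by blast
  then have "\<pi>' i = \<pi> i" "\<pi>' j = \<pi> j" using assms(2) by auto
  then show ?thesis unfolding upper_right_def using ij
    by (intro exI[of _ i] exI[of _ j]) simp
qed

lemma frame_upper_right: "frame n R \<pi> = frame n R \<pi>' \<Longrightarrow> upper_right n R \<pi> c y \<longleftrightarrow> upper_right n R \<pi>' c y"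
  unfolding frame_def by (auto simp: set_eq_iff)

lemma frame_outside:
  assumes "frame n R \<pi> = frame n R \<pi>'" "i \<in> {1..n}" "\<not> upper_right n R \<pi> i (\<pi> i)"
  shows "\<pi>' i = \<pi> i"
proof -
  have "(i, \<pi> i) \<in> snd (frame n R \<pi>')" using assms by (auto simp: frame_def[of n R \<pi>] simp flip: assms(1))
  then show ?thesis by (auto simp: frame_def)
qed

lemma frame_inside:
  assumes "frame n R \<pi> = frame n R \<pi>'" "i \<in> {1..n}" "upper_right n R \<pi> i (\<pi> i)"
  shows "upper_right n R \<pi>' i (\<pi>' i)"
  using frame_outside[OF assms(1)[symmetric] assms(2)] frame_upper_right[OF assms(1)] assms(3) by metis

text \<open>Both dots lie inside the diagram before and after the swap, and the outside dots alone
  determine the diagram.\<close>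

lemma frame_swap:
  assumes pq: "1 \<le> p" "p < q" "q \<le> n" and u: "upper_right n R \<pi> q (\<pi> p)" "upper_right n R \<pi> q (\<pi> q)"
  shows "frame n R (\<pi> \<circ> transpose p q) = frame n R \<pi>"
proof -
  let ?\<pi> = "\<pi> \<circ> transpose p q"
  have ps: "?\<pi> p = \<pi> q" "?\<pi> q = \<pi> p" "\<And>i. i \<noteq> p \<Longrightarrow> i \<noteq> q \<Longrightarrow> ?\<pi> i = \<pi> i"
    by (auto simp: transpose_def)
  have up: "upper_right n R \<pi> p (\<pi> p)" "upper_right n R \<pi> p (\<pi> q)"
    using upper_right_mono u pq by (meson less_imp_le order_refl)+
  have 1: "upper_right n R ?\<pi> c y" if "upper_right n R \<pi> c y" for c y
    using that
  proof (rule upper_right_transfer)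
    fix i assume "\<not> upper_right n R \<pi> i (\<pi> i)"
    then have "i \<noteq> p" "i \<noteq> q" using up u by auto
    then show "?\<pi> i = \<pi> i" by (rule ps(3))
  qed
  \<comment> \<open>The reverse inclusion: by \<open>1\<close> the swapped dots are also inside the
    diagram of \<open>?\<pi>\<close>.\<close>
  have 2: "upper_right n R \<pi> c y" if "upper_right n R ?\<pi> c y" for c y
    using that
  proof (rule upper_right_transfer)
    fix i assume "\<not> upper_right n R ?\<pi> i (?\<pi> i)"
    then have "i \<noteq> p" "i \<noteq> q" using 1[OF up(2)] 1[OF u(1)] ps(1,2) by auto
    then show "\<pi> i = ?\<pi> i" using ps by simp
  qed
  have 3: "upper_right n R ?\<pi> c y = upper_right n R \<pi> c y" for c y using 1 2 by blast
  have 4: "(\<not> upper_right n R \<pi> i (?\<pi> i)) = (\<not> upper_right n R \<pi> i (\<pi> i))"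
    "\<not> upper_right n R \<pi> i (\<pi> i) \<Longrightarrow> ?\<pi> i = \<pi> i" for i
    using ps(1,2) ps(3)[of i] up u by (cases "i = p"; cases "i = q"; simp)+
  have "{(i, ?\<pi> i) | i. i \<in> {1..n} \<and> \<not> upper_right n R \<pi> i (?\<pi> i)} =
    {(i, \<pi> i) | i. i \<in> {1..n} \<and> \<not> upper_right n R \<pi> i (\<pi> i)}"
  proof (intro Collect_cong ex_cong1)
    fix z i
    show "z = (i, ?\<pi> i) \<and> i \<in> {1..n} \<and> \<not> upper_right n R \<pi> i (?\<pi> i) \<longleftrightarrow>
      z = (i, \<pi> i) \<and> i \<in> {1..n} \<and> \<not> upper_right n R \<pi> i (\<pi> i)"
      using 4[of i] by metis
  qed
  then show ?thesis unfolding frame_def 3 by simp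
qed

section \<open>Uniqueness and existence in a fibre of \<open>frame\<close>\<close>

text \<open>Here \<open>q\<close> is the last position where the two differ, and both dots in that
  column are inside the diagram. Each permutation must use the other's value at \<open>q\<close>
  further to the left, which yields an ascending pair in \<open>\<pi>'\<close> and a descending one
  in \<open>\<pi>\<close>.\<close>

lemma frame_unique_less:
  assumes perm: "\<pi> permutes {1..n}" "\<pi>' permutes {1..n}" and fr: "frame n R \<pi> = frame n R \<pi>'"
    and q: "q \<in> {1..n}" "\<And>r. r > q \<Longrightarrow> \<pi> r = \<pi>' r" and lt: "\<pi> q < \<pi>' q"
  shows "has_asc n R \<pi>'" "has_desc n R \<pi>"
proof -
  have inj: "inj \<pi>" "inj \<pi>'" using perm permutes_inj by blast+
  have u: "upper_right n R \<pi> q (\<pi> q)" "upper_right n R \<pi>' q (\<pi>' q)"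
    using frame_outside[OF fr q(1)] frame_outside[OF fr[symmetric] q(1)] lt by auto
  define p where "p = inv \<pi>' (\<pi> q)"
  have p: "\<pi>' p = \<pi> q" "p \<in> {1..n}" unfolding p_def
    using permutes_inverses[OF perm(2)] permutes_in_image[OF permutes_inv[OF perm(2)]] permutes_in_image[OF perm(1)] q(1)
    by blast+
  have "p < q"
    using p q(2)[of p] lt inj by (metis injD linorder_neqE_nat less_irrefl)
  then show "has_asc n R \<pi>'" unfolding has_asc_def using p q(1) u(2) lt
    by (intro exI[of _ p] exI[of _ q]) simp
  define p' where "p' = inv \<pi> (\<pi>' q)"
  have p': "\<pi> p' = \<pi>' q" "p' \<in> {1..n}" unfolding p'_def
    using permutes_inverses[OF perm(1)] permutes_in_image[OF permutes_inv[OF perm(1)]] permutes_in_image[OF perm(2)] q(1)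
    by blast+
  have "p' < q"
    using p' q(2)[of p'] lt inj by (metis injD linorder_neqE_nat less_irrefl)
  then show "has_desc n R \<pi>" unfolding has_desc_def using p' q(1) u(2) lt frame_upper_right[OF fr]
    by (intro exI[of _ p'] exI[of _ q]) simp
qed

lemma frame_unique:
  assumes perm: "\<pi> permutes {1..n}" "\<pi>' permutes {1..n}" and fr: "frame n R \<pi> = frame n R \<pi>'"
    and av: "\<not> has_asc n R \<pi> \<and> \<not> has_asc n R \<pi>' \<or> \<not> has_desc n R \<pi> \<and> \<not> has_desc n R \<pi>'"
  shows "\<pi> = \<pi>'"
proof (rule ccontr)
  assume "\<pi> \<noteq> \<pi>'"
  define D where "D = {q \<in> {1..n}. \<pi> q \<noteq> \<pi>' q}"
  have out: "\<pi> r = \<pi>' r" if "r \<notin> {1..n}" for r using perm that by (simp add: permutes_not_in)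
  then have "\<exists>q \<in> {1..n}. \<pi> q \<noteq> \<pi>' q" using \<open>\<pi> \<noteq> \<pi>'\<close> by blast
  then have "D \<noteq> {}" "finite D" unfolding D_def by auto
  then have "Max D \<in> D" "\<And>r. r \<in> D \<Longrightarrow> r \<le> Max D" by auto
  then obtain q where q: "q \<in> D" "\<And>r. r > q \<Longrightarrow> r \<notin> D" by (metis not_le)
  have eq: "\<pi> r = \<pi>' r" "\<pi>' r = \<pi> r" if "r > q" for r using q(2)[OF that] out[of r] unfolding D_def by auto
  have qn: "q \<in> {1..n}" "\<pi> q \<noteq> \<pi>' q" using q unfolding D_def by auto
  then consider "\<pi> q < \<pi>' q" | "\<pi>' q < \<pi> q" by linarith
  then show False
  proof cases
    case 1
    then show False using frame_unique_less[OF perm fr qn(1) eq(1)] av by blast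
  next
    case 2
    then show False using frame_unique_less[OF perm(2,1) fr[symmetric] qn(1) eq(2)] av by blast
  qed
qed

text \<open>The difference of the sums is \<open>(q - p) * (\<pi> q - \<pi> p)\<close>.\<close>

lemma sum_swap_less:
  fixes \<pi> :: "nat \<Rightarrow> nat"
  assumes "1 \<le> p" "p < q" "q \<le> n" "\<pi> p < \<pi> q"
  shows "(\<Sum>i\<in>{1..n}. i * (\<pi> \<circ> transpose p q) i) < (\<Sum>i\<in>{1..n}. i * \<pi> i)"
proof -
  have split: "(\<Sum>i\<in>{1..n}. i * f i) = p * f p + (q * f q + (\<Sum>i\<in>{1..n}-{p}-{q}. i * f i))" for f :: "nat \<Rightarrow> nat"
    using assms by (subst sum.remove[of _ p], simp, simp, subst sum.remove[of _ q]) auto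
  have "(\<Sum>i\<in>{1..n}-{p}-{q}. i * (\<pi> \<circ> transpose p q) i) = (\<Sum>i\<in>{1..n}-{p}-{q}. i * \<pi> i)"
    by (rule sum.cong) (auto simp: transpose_def)
  moreover have "p * \<pi> q + q * \<pi> p < p * \<pi> p + q * \<pi> q"
  proof -
    obtain d e where "q = Suc (p + d)" "\<pi> q = Suc (\<pi> p + e)"
      using less_imp_Suc_add[OF assms(2)] less_imp_Suc_add[OF assms(4)] by auto
    then show ?thesis by (simp add: algebra_simps)
  qed
  ultimately show ?thesis unfolding split by simp
qed

lemma permutes_swap: "\<pi> permutes {1..n::nat} \<Longrightarrow> 1 \<le> p \<Longrightarrow> p < q \<Longrightarrow> q \<le> n \<Longrightarrow> \<pi> \<circ> transpose p q permutes {1..n}"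
  by (rule permutes_compose[rotated]) (auto intro!: permutes_swap_id simp del: One_nat_def)

text \<open>In a fibre of \<^const>\<open>frame\<close>, the minimum of \<open>\<Sum>i. i * \<pi> i\<close> has no ascending pair and the maximum has no
  descending pair, because such pairs could be swapped.\<close>

lemma frame_representatives:
  assumes "\<pi> permutes {1..n}"
  shows "\<exists>\<pi>'. \<pi>' permutes {1..n} \<and> frame n R \<pi>' = frame n R \<pi> \<and> \<not> has_asc n R \<pi>'"
    and "\<exists>\<pi>'. \<pi>' permutes {1..n} \<and> frame n R \<pi>' = frame n R \<pi> \<and> \<not> has_desc n R \<pi>'"
proof -
  define S where "S = {\<pi>'. \<pi>' permutes {1..n} \<and> frame n R \<pi>' = frame n R \<pi>}"
  define f where "f = (\<lambda>\<pi> :: nat \<Rightarrow> nat. \<Sum>i\<in>{1..n}. i * \<pi> i)"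
  have "finite S" unfolding S_def by (rule finite_subset[OF _ finite_permutations[of "{1..n}"]]) auto
  moreover have "\<pi> \<in> S" unfolding S_def using assms by simp
  ultimately have im: "finite (f ` S)" "f ` S \<noteq> {}" by auto
  have "Min (f ` S) \<in> f ` S" "Max (f ` S) \<in> f ` S" using im Min_in Max_in by blast+
  then obtain \<alpha> \<beta> where ab: "\<alpha> \<in> S" "f \<alpha> = Min (f ` S)" "\<beta> \<in> S" "f \<beta> = Max (f ` S)"
    by (metis imageE)
  have \<alpha>: "\<alpha> \<in> S" "\<And>\<sigma>. \<sigma> \<in> S \<Longrightarrow> f \<alpha> \<le> f \<sigma>" and \<beta>: "\<beta> \<in> S" "\<And>\<sigma>. \<sigma> \<in> S \<Longrightarrow> f \<sigma> \<le> f \<beta>"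
    using ab im(1) by auto
  have "\<not> has_asc n R \<alpha>"
  proof
    assume "has_asc n R \<alpha>"
    then obtain p q where pq: "1 \<le> p" "p < q" "q \<le> n" "\<alpha> p < \<alpha> q" "upper_right n R \<alpha> q (\<alpha> q)"
      unfolding has_asc_def by blast
    then have "upper_right n R \<alpha> q (\<alpha> p)" by (meson upper_right_mono order_refl less_imp_le)
    then have "\<alpha> \<circ> transpose p q \<in> S"
      using pq \<alpha>(1) permutes_swap[of \<alpha> n p q] frame_swap[of p q n R \<alpha>] unfolding S_def by auto
    then show False using \<alpha>(2) sum_swap_less[of p q n \<alpha>] pq unfolding f_def by (meson not_le)
  qed
  then show "\<exists>\<pi>'. \<pi>' permutes {1..n} \<and> frame n R \<pi>' = frame n R \<pi> \<and> \<not> has_asc n R \<pi>'"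
    using \<alpha>(1) unfolding S_def by blast
  have "\<not> has_desc n R \<beta>"
  proof
    assume "has_desc n R \<beta>"
    then obtain p q where pq: "1 \<le> p" "p < q" "q \<le> n" "\<beta> q < \<beta> p" "upper_right n R \<beta> q (\<beta> p)"
      unfolding has_desc_def by blast
    then have "upper_right n R \<beta> q (\<beta> q)" by (meson upper_right_mono order_refl less_imp_le)
    then have s: "\<beta> \<circ> transpose p q \<in> S"
      using pq \<beta>(1) permutes_swap[of \<beta> n p q] frame_swap[of p q n R \<beta>] unfolding S_def by auto
    \<comment> \<open>Undoing the swap lowers the sum, so the swap itself raises it, against the
      maximality of \<open>f \<beta>\<close>.\<close>
    have "(\<beta> \<circ> transpose p q) \<circ> transpose p q = \<beta>" by (simp add: comp_assoc)
    then have "f \<beta> < f (\<beta> \<circ> transpose p q)"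
      using sum_swap_less[of p q n "\<beta> \<circ> transpose p q"] pq unfolding f_def by simp
    then show False using \<beta>(2)[OF s] by simp
  qed
  then show "\<exists>\<pi>'. \<pi>' permutes {1..n} \<and> frame n R \<pi>' = frame n R \<pi> \<and> \<not> has_desc n R \<pi>'"
    using \<beta>(1) unfolding S_def by blast
qed

section \<open>Reflection in the diagonal\<close>

text \<open>Inversion reflects the dots in the diagonal. An ascending pair keeps its order, while in
  a descending pair the two dots change places; the patterns 12 and 21 are their own
  inverses.\<close>

lemma upper_right_inv:
  assumes R: "R = (<) \<or> R = (>)" and perm: "\<pi> permutes {1..n}" and u: "upper_right n R \<pi> c y"
  shows "upper_right n R (inv \<pi>) y c"
proof -
  obtain i j where ij: "c < i" "i < j" "j \<le> n" "y < \<pi> i" "y < \<pi> j" "R (\<pi> i) (\<pi> j)"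
    using u unfolding upper_right_def by blast
  then have "i \<in> {1..n}" "j \<in> {1..n}" by auto
  then have "\<pi> i \<in> {1..n}" "\<pi> j \<in> {1..n}" using permutes_in_image[OF perm] by blast+
  then have *: "\<pi> i \<le> n" "\<pi> j \<le> n" "inv \<pi> (\<pi> i) = i" "inv \<pi> (\<pi> j) = j"
    using permutes_inverses[OF perm] by auto
  have "\<pi> i < \<pi> j \<or> \<pi> j < \<pi> i" "R = (<) \<Longrightarrow> \<pi> i < \<pi> j" "R = (>) \<Longrightarrow> \<pi> j < \<pi> i"
    using R ij(6) by auto
  then show ?thesis using R
  proof (elim disjE)
    assume "R = (<)" "\<pi> i < \<pi> j"
    then show ?thesis unfolding upper_right_def using * ij by (intro exI[of _ "\<pi> i"] exI[of _ "\<pi> j"]) simp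
  next
    assume "R = (>)" "\<pi> j < \<pi> i"
    then show ?thesis unfolding upper_right_def using * ij by (intro exI[of _ "\<pi> j"] exI[of _ "\<pi> i"]) simp
  qed auto
qed

lemma has_asc_inv:
  assumes R: "R = (<) \<or> R = (>)" and perm: "\<pi> permutes {1..n}" and h: "has_asc n R \<pi>"
  shows "has_asc n R (inv \<pi>)"
proof -
  obtain p q where pq: "1 \<le> p" "p < q" "q \<le> n" "\<pi> p < \<pi> q" "upper_right n R \<pi> q (\<pi> q)"
    using h unfolding has_asc_def by blast
  then have "p \<in> {1..n}" "q \<in> {1..n}" by auto
  then have "\<pi> p \<in> {1..n}" "\<pi> q \<in> {1..n}" using permutes_in_image[OF perm] by blast+
  moreover have "inv \<pi> (\<pi> p) = p" "inv \<pi> (\<pi> q) = q" using perm by (simp_all add: permutes_inverses)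
  ultimately show ?thesis unfolding has_asc_def using pq upper_right_inv[OF R perm pq(5)]
    by (intro exI[of _ "\<pi> p"] exI[of _ "\<pi> q"]) auto
qed

lemma has_desc_inv:
  assumes R: "R = (<) \<or> R = (>)" and perm: "\<pi> permutes {1..n}" and h: "has_desc n R \<pi>"
  shows "has_desc n R (inv \<pi>)"
proof -
  obtain p q where pq: "1 \<le> p" "p < q" "q \<le> n" "\<pi> q < \<pi> p" "upper_right n R \<pi> q (\<pi> p)"
    using h unfolding has_desc_def by blast
  then have "p \<in> {1..n}" "q \<in> {1..n}" by auto
  then have "\<pi> p \<in> {1..n}" "\<pi> q \<in> {1..n}" using permutes_in_image[OF perm] by blast+
  moreover have "inv \<pi> (\<pi> p) = p" "inv \<pi> (\<pi> q) = q" using perm by (simp_all add: permutes_inverses)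
  ultimately show ?thesis unfolding has_desc_def using pq upper_right_inv[OF R perm pq(5)]
    by (intro exI[of _ "\<pi> q"] exI[of _ "\<pi> p"]) auto
qed

text \<open>Reflection swaps the coordinates in both components of the frame, so the new frame
  depends only on the old one.\<close>

lemma frame_inv:
  assumes R: "R = (<) \<or> R = (>)" and perm: "\<pi> permutes {1..n}" "\<pi>' permutes {1..n}"
    and fr: "frame n R \<pi> = frame n R \<pi>'"
  shows "frame n R (inv \<pi>) = frame n R (inv \<pi>')"
proof -
  have flip: "upper_right n R (inv \<sigma>) y c \<longleftrightarrow> upper_right n R \<sigma> c y" if "\<sigma> permutes {1..n}" for \<sigma> c y
    using upper_right_inv[OF R that, of c y] upper_right_inv[OF R permutes_inv[OF that], of y c]
    by (auto simp: permutes_inv_inv[OF that])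
  have dots: "snd (frame n R (inv \<sigma>)) = prod.swap ` snd (frame n R \<sigma>)" if s: "\<sigma> permutes {1..n}" for \<sigma>
  proof -
    have "snd (frame n R (inv \<sigma>)) = {(i, inv \<sigma> i) | i. i \<in> {1..n} \<and> \<not> upper_right n R \<sigma> (inv \<sigma> i) i}"
      unfolding frame_def flip[OF s] by simp
    also have "\<dots> = {(\<sigma> i, i) | i. i \<in> {1..n} \<and> \<not> upper_right n R \<sigma> i (\<sigma> i)}" (is "?A = ?B")
    proof (intro equalityI subsetI)
      fix z assume "z \<in> ?A"
      then obtain i where i: "z = (i, inv \<sigma> i)" "i \<in> {1..n}" "\<not> upper_right n R \<sigma> (inv \<sigma> i) i" by blast
      have "inv \<sigma> i \<in> {1..n}" "\<sigma> (inv \<sigma> i) = i"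
        using i(2) permutes_in_image[OF permutes_inv[OF s]] permutes_inverses[OF s] by blast+
      then show "z \<in> ?B" using i by (intro CollectI exI[of _ "inv \<sigma> i"]) simp
    next
      fix z assume "z \<in> ?B"
      then obtain i where i: "z = (\<sigma> i, i)" "i \<in> {1..n}" "\<not> upper_right n R \<sigma> i (\<sigma> i)" by blast
      have "\<sigma> i \<in> {1..n}" "inv \<sigma> (\<sigma> i) = i"
        using i(2) permutes_in_image[OF s] permutes_inverses[OF s] by blast+
      then show "z \<in> ?A" using i by (intro CollectI exI[of _ "\<sigma> i"]) simp
    qed
    also have "\<dots> = prod.swap ` snd (frame n R \<sigma>)" unfolding frame_def by force
    finally show ?thesis .
  qed
  have "fst (frame n R (inv \<pi>)) = fst (frame n R (inv \<pi>'))"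
    unfolding frame_def using flip perm frame_upper_right[OF fr] by auto
  moreover have "snd (frame n R (inv \<pi>)) = snd (frame n R (inv \<pi>'))" using dots perm fr by metis
  ultimately show ?thesis by (simp add: prod_eq_iff)
qed

section \<open>Preservation of alternation\<close>

text \<open>A peak inside the diagram would form an ascending pair with its left neighbour and a
  descending pair with its right neighbour, so both patterns would occur. If
  \<open>Suc m = n\<close>, the last place is unconstrained, but a dot inside the diagram has two
  places to its right, so \<open>i + 1 \<le> m\<close> still holds.\<close>

lemma alternating_peak_outside:
  assumes perm: "\<pi> permutes {1..n}" and alt: "alternating m \<pi>" and m: "m = n \<or> Suc m = n"
    and av: "\<not> has_asc n R \<pi> \<or> \<not> has_desc n R \<pi>" and i: "even i" "1 \<le> i" "i \<le> m"
  shows "\<not> upper_right n R \<pi> i (\<pi> i)"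
proof
  assume u: "upper_right n R \<pi> i (\<pi> i)"
  have i2: "2 \<le> i" using i by (cases "i = 1") auto
  have "odd (i - 1)" "i - 1 + 1 = i" using i i2 by auto
  then have "\<pi> (i - 1) < \<pi> i"
    using alt[unfolded alternating_def, rule_format, of "i - 1"] i i2 by simp
  then have "has_asc n R \<pi>" unfolding has_asc_def using i2 i m u
    by (intro exI[of _ "i - 1"] exI[of _ i]) auto
  moreover have "has_desc n R \<pi>"
  proof -
    obtain k l where kl: "i < k" "k < l" "l \<le> n" "\<pi> i < \<pi> k" "\<pi> i < \<pi> l" "R (\<pi> k) (\<pi> l)"
      using u unfolding upper_right_def by blast
    then have "i + 1 \<le> m" using m by auto
    then have d: "\<not> \<pi> i < \<pi> (i + 1)" using alt i unfolding alternating_def by blast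
    then have "k \<noteq> i + 1" using kl by auto
    then have "i + 1 < k" using kl by simp
    then have "upper_right n R \<pi> (i + 1) (\<pi> i)" unfolding upper_right_def using kl by blast
    moreover have "\<pi> (i + 1) \<noteq> \<pi> i" using permutes_inj[OF perm] by (simp add: inj_eq)
    ultimately show ?thesis unfolding has_desc_def using d i kl by (intro exI[of _ i] exI[of _ "i + 1"]) auto
  qed
  ultimately show False using av by blast
qed

text \<open>Peaks lie outside the diagram and stay fixed, so only a valley can move. If it rose to
  the height of an adjacent peak, whatever lies to its upper right would also lie to the upper right
  of that peak, which is outside.\<close>

lemma alternating_frame:
  assumes perm: "\<pi> permutes {1..n}" and fr: "frame n R \<pi> = frame n R \<pi>'"
    and alt: "alternating m \<pi>" and m: "m = n \<or> Suc m = n"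
    and av: "\<not> has_asc n R \<pi> \<or> \<not> has_desc n R \<pi>"
  shows "alternating m \<pi>'"
proof -
  have peak: "\<not> upper_right n R \<pi> p (\<pi> p)" "\<pi>' p = \<pi> p" if "even p" "1 \<le> p" "p \<le> m" for p
  proof -
    show *: "\<not> upper_right n R \<pi> p (\<pi> p)" by (rule alternating_peak_outside[OF perm alt m av that])
    show "\<pi>' p = \<pi> p" using frame_outside[OF fr _ *] that m by auto
  qed
  have valley: "\<pi>' v < \<pi>' p"
    if p: "even p" "1 \<le> p" "p \<le> m" and v: "1 \<le> v" "v \<le> m" "v = p + 1 \<or> p = v + 1" and lt: "\<pi> v < \<pi> p" for p v
  proof (cases "upper_right n R \<pi> v (\<pi> v)")
    case False
    then have "\<pi>' v = \<pi> v" using frame_outside[OF fr _ False] v m by auto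
    then show ?thesis using lt peak[OF p] by simp
  next
    case True
    then have u: "upper_right n R \<pi>' v (\<pi>' v)" using frame_inside[OF fr _ True] v m by auto
    have np: "\<not> upper_right n R \<pi>' p (\<pi>' p)" using peak[OF p] frame_upper_right[OF fr] by simp
    show ?thesis
    proof (rule ccontr)
      assume le: "\<not> \<pi>' v < \<pi>' p"
      obtain k l where kl: "v < k" "k < l" "l \<le> n" "\<pi>' v < \<pi>' k" "\<pi>' v < \<pi>' l" "R (\<pi>' k) (\<pi>' l)"
        using u unfolding upper_right_def by blast
      then have "k \<noteq> p" using le by auto
      then have "p < k" using v(3) kl(1) by auto
      then have "upper_right n R \<pi>' p (\<pi>' p)" unfolding upper_right_def using kl le
        by (intro exI[of _ k] exI[of _ l]) simp
      then show False using np by simp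
    qed
  qed
  show ?thesis unfolding alternating_def
  proof (intro allI impI)
    fix i assume i: "1 \<le> i \<and> i + 1 \<le> m"
    then have a: "\<pi> i < \<pi> (i + 1) \<longleftrightarrow> odd i" using alt unfolding alternating_def by blast
    have ne: "\<pi> i \<noteq> \<pi> (i + 1)" using permutes_inj[OF perm] by (simp add: inj_eq)
    show "\<pi>' i < \<pi>' (i + 1) \<longleftrightarrow> odd i"
    proof (cases "odd i")
      case True
      then show ?thesis using valley[of "i + 1" i] a i by auto
    next
      case False
      then show ?thesis using valley[of i "i + 1"] a i ne by auto
    qed
  qed
qed

text \<open>Alternation is required of the first \<open>m\<close> entries only: \<open>m = n\<close>
  gives \<open>AI n\<close>, and \<open>Suc m = n\<close> is the situation after the removal of the
  cycle \<open>(1, N - 1)\<close>.\<close>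

definition invol_alt :: "nat \<Rightarrow> nat \<Rightarrow> (nat \<Rightarrow> nat) set" where
  "invol_alt n m = {\<pi>. \<pi> permutes {1..n} \<and> \<pi> = inv \<pi> \<and> alternating m \<pi>}"

text \<open>As \<open>\<pi>\<close> is an involution, its frame is symmetric; hence
  \<open>inv \<pi>'\<close> has the frame of \<open>\<pi>'\<close>. It also avoids what
  \<open>\<pi>'\<close> avoids, so uniqueness makes them equal.\<close>

lemma invol_alt_frame:
  assumes R: "R = (<) \<or> R = (>)" and m: "m = n \<or> Suc m = n"
    and \<pi>: "\<pi> \<in> invol_alt n m" "\<not> has_asc n R \<pi> \<or> \<not> has_desc n R \<pi>"
    and \<pi>': "\<pi>' permutes {1..n}" "frame n R \<pi>' = frame n R \<pi>" "\<not> has_asc n R \<pi>' \<or> \<not> has_desc n R \<pi>'"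
  shows "\<pi>' \<in> invol_alt n m"
proof -
  have perm: "\<pi> permutes {1..n}" and i: "inv \<pi> = \<pi>" and alt: "alternating m \<pi>"
    using \<pi>(1) unfolding invol_alt_def by auto
  have ip: "inv \<pi>' permutes {1..n}" by (rule permutes_inv[OF \<pi>'(1)])
  have "frame n R (inv \<pi>') = frame n R (inv \<pi>)" by (rule frame_inv[OF R \<pi>'(1) perm \<pi>'(2)])
  then have fr: "frame n R (inv \<pi>') = frame n R \<pi>'" using i \<pi>'(2) by simp
  have "inv \<pi>' = \<pi>'"
    by (rule frame_unique[OF ip \<pi>'(1) fr])
      (use \<pi>'(3) has_asc_inv[OF R ip] has_desc_inv[OF R ip] permutes_inv_inv[OF \<pi>'(1)] in auto)
  moreover have "alternating m \<pi>'"
    by (rule alternating_frame[OF perm \<pi>'(2)[symmetric] alt m \<pi>(2)])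
  ultimately show ?thesis using \<pi>'(1) unfolding invol_alt_def by auto
qed

text \<open>On both sides \<open>frame\<close> is injective, and the two images agree: a frame
  arising on one side has a representative of the other kind, which again belongs to
  \<open>invol_alt n m\<close>.\<close>

lemma card_asc_desc:
  assumes R: "R = (<) \<or> R = (>)" and m: "m = n \<or> Suc m = n"
  shows "card {\<pi> \<in> invol_alt n m. \<not> has_asc n R \<pi>} = card {\<pi> \<in> invol_alt n m. \<not> has_desc n R \<pi>}"
    (is "card ?A = card ?D")
proof -
  have inj: "inj_on (frame n R) ?A" "inj_on (frame n R) ?D"
    by (auto intro!: inj_onI frame_unique[of _ n _ R] simp: invol_alt_def)
  have "frame n R ` ?A = frame n R ` ?D"
  proof (intro equalityI subsetI)
    fix z assume "z \<in> frame n R ` ?A"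
    then obtain \<pi> where \<pi>: "\<pi> \<in> invol_alt n m" "\<not> has_asc n R \<pi>" "z = frame n R \<pi>" by blast
    then have "\<pi> permutes {1..n}" unfolding invol_alt_def by blast
    from frame_representatives(2)[OF this, of R] obtain \<pi>' where \<pi>': "\<pi>' permutes {1..n}" "frame n R \<pi>' = frame n R \<pi>" "\<not> has_desc n R \<pi>'"
      by blast
    then have "\<pi>' \<in> invol_alt n m" using invol_alt_frame[OF R m \<pi>(1) _ \<pi>'(1,2)] \<pi> by blast
    then show "z \<in> frame n R ` ?D" using \<pi>' \<pi> by (intro image_eqI[of _ _ \<pi>']) auto
  next
    fix z assume "z \<in> frame n R ` ?D"
    then obtain \<pi> where \<pi>: "\<pi> \<in> invol_alt n m" "\<not> has_desc n R \<pi>" "z = frame n R \<pi>" by blast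
    then have "\<pi> permutes {1..n}" unfolding invol_alt_def by blast
    from frame_representatives(1)[OF this, of R] obtain \<pi>' where \<pi>': "\<pi>' permutes {1..n}" "frame n R \<pi>' = frame n R \<pi>" "\<not> has_asc n R \<pi>'"
      by blast
    then have "\<pi>' \<in> invol_alt n m" using invol_alt_frame[OF R m \<pi>(1) _ \<pi>'(1,2)] \<pi> by blast
    then show "z \<in> frame n R ` ?A" using \<pi>' \<pi> by (intro image_eqI[of _ _ \<pi>']) auto
  qed
  then show ?thesis using card_image[OF inj(1)] card_image[OF inj(2)] by simp
qed

lemma contains_iff_has:
  "contains_pattern n \<pi> [1, 2, 4, 3] \<longleftrightarrow> has_asc n (>) \<pi>"
  "contains_pattern n \<pi> [2, 1, 4, 3] \<longleftrightarrow> has_desc n (>) \<pi>"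
  "contains_pattern n \<pi> [1, 2, 3, 4] \<longleftrightarrow> has_asc n (<) \<pi>"
  "contains_pattern n \<pi> [2, 1, 3, 4] \<longleftrightarrow> has_desc n (<) \<pi>"
  unfolding contains_1243 contains_2143 contains_1234 contains_2134 has_asc_def has_desc_def upper_right_def
  by (meson less_imp_le less_le_trans less_trans)+

lemma card_AI_1243_2143: "card (AI_av n [1, 2, 4, 3]) = card (AI_av n [2, 1, 4, 3])"
  using card_asc_desc[of "(>)" n n] unfolding AI_av_def AI_def invol_alt_def contains_iff_has by simp

lemma card_invol_alt_1234_2134:
  "card {\<pi> \<in> invol_alt (Suc m) m. \<not> contains_pattern (Suc m) \<pi> [1, 2, 3, 4]} =
   card {\<pi> \<in> invol_alt (Suc m) m. \<not> contains_pattern (Suc m) \<pi> [2, 1, 3, 4]}"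
  using card_asc_desc[of "(<)" m "Suc m"] unfolding contains_iff_has by simp

section \<open>Reverse-complement\<close>

text \<open>Outside \<open>{1..n}\<close> it is the identity, so that conjugation by it preserves
  the permutations of \<open>{1..n}\<close>.\<close>

definition flip :: "nat \<Rightarrow> nat \<Rightarrow> nat" where
  "flip n i = (if 1 \<le> i \<and> i \<le> n then n + 1 - i else i)"

definition rev_compl :: "nat \<Rightarrow> (nat \<Rightarrow> nat) \<Rightarrow> nat \<Rightarrow> nat" where
  "rev_compl n \<pi> = flip n \<circ> \<pi> \<circ> flip n"

lemma flip_flip: "flip n \<circ> flip n = id"
  unfolding flip_def by (auto simp: fun_eq_iff)

lemma flip_permutes: "flip n permutes {1..n}"
  by (rule bij_imp_permutes, rule bij_betw_byWitness[where f' = "flip n"]) (auto simp: flip_def)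

lemma inv_flip: "inv (flip n) = flip n"
  using flip_flip by (rule inv_unique_comp) (rule flip_flip)

lemma rev_compl_rev_compl: "rev_compl n (rev_compl n \<pi>) = \<pi>"
proof -
  have "rev_compl n (rev_compl n \<pi>) = (flip n \<circ> flip n) \<circ> \<pi> \<circ> (flip n \<circ> flip n)"
    unfolding rev_compl_def by (simp only: comp_assoc)
  then show ?thesis by (simp add: flip_flip)
qed

lemma rev_compl_permutes: "\<pi> permutes {1..n} \<Longrightarrow> rev_compl n \<pi> permutes {1..n}"
  unfolding rev_compl_def by (intro permutes_compose flip_permutes)

lemma rev_compl_inv:
  assumes "\<pi> permutes {1..n}"
  shows "inv (rev_compl n \<pi>) = rev_compl n (inv \<pi>)"
proof -
  have b: "bij (flip n)" "bij \<pi>" using flip_permutes assms by (auto intro: permutes_bij)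
  then have "inv (flip n \<circ> \<pi> \<circ> flip n) = inv (flip n) \<circ> (inv \<pi> \<circ> inv (flip n))"
    by (subst o_inv_distrib, auto intro: bij_comp, subst o_inv_distrib) auto
  then show ?thesis unfolding rev_compl_def by (simp add: inv_flip comp_assoc)
qed

lemma rev_compl_less:
  assumes "\<pi> permutes {1..n}" "i \<in> {1..n}" "j \<in> {1..n}"
  shows "rev_compl n \<pi> i < rev_compl n \<pi> j \<longleftrightarrow> \<pi> (n + 1 - j) < \<pi> (n + 1 - i)"
proof -
  have "n + 1 - i \<in> {1..n}" "n + 1 - j \<in> {1..n}" using assms by auto
  then have "\<pi> (n + 1 - i) \<in> {1..n}" "\<pi> (n + 1 - j) \<in> {1..n}" using permutes_in_image[OF assms(1)] by blast+
  moreover have "a \<in> {1..n} \<Longrightarrow> b \<in> {1..n} \<Longrightarrow> flip n a < flip n b \<longleftrightarrow> b < a" for a b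
    unfolding flip_def by auto
  moreover have "flip n i = n + 1 - i" "flip n j = n + 1 - j" using assms(2,3) by (auto simp: flip_def)
  ultimately show ?thesis unfolding rev_compl_def by simp
qed

text \<open>Reverse-complement moves a descent from \<open>n - i\<close> to \<open>i\<close>, and
  for odd \<open>n\<close> these positions have opposite parity.\<close>

lemma rev_compl_alternating:
  assumes "\<pi> permutes {1..n}" "odd n"
  shows "reverse_alternating n (rev_compl n \<pi>) \<longleftrightarrow> alternating n \<pi>"
proof -
  have ne: "\<pi> (Suc i) \<noteq> \<pi> i" for i using permutes_inj[OF assms(1)] by (simp add: inj_eq)
  have 1: "rev_compl n \<pi> (i + 1) < rev_compl n \<pi> i \<longleftrightarrow> \<not> \<pi> (n - i) < \<pi> (n - i + 1)" if "1 \<le> i" "i + 1 \<le> n" for i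
    using rev_compl_less[OF assms(1), of "i + 1" i] ne[of "n - i"] that by (auto simp: Suc_diff_le)
  have 2: "odd i \<longleftrightarrow> even (n - i)" if "i \<le> n" for i using assms(2) that by auto
  show ?thesis
  proof
    assume l: "reverse_alternating n (rev_compl n \<pi>)"
    show "alternating n \<pi>" unfolding alternating_def
    proof (intro allI impI)
      fix i assume i: "1 \<le> i \<and> i + 1 \<le> n"
      then have "1 \<le> n - i" "n - i + 1 \<le> n" "n - (n - i) = i" by auto
      then show "\<pi> i < \<pi> (i + 1) \<longleftrightarrow> odd i"
        using l[unfolded reverse_alternating_def, rule_format, of "n - i"] 1[of "n - i"] 2[of i] i by auto
    qed
  next
    assume r: "alternating n \<pi>"
    show "reverse_alternating n (rev_compl n \<pi>)" unfolding reverse_alternating_def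
    proof (intro allI impI)
      fix i assume i: "1 \<le> i \<and> i + 1 \<le> n"
      then have "1 \<le> n - i \<and> n - i + 1 \<le> n" by auto
      with i show "rev_compl n \<pi> (i + 1) < rev_compl n \<pi> i \<longleftrightarrow> odd i"
        using r[unfolded alternating_def, rule_format, of "n - i"] 1[of i] 2[of i] by auto
    qed
  qed
qed

text \<open>Positions and values are both reflected by \<open>x \<mapsto> n + 1 - x\<close>; this
  takes 1243 to 2134 and back, and fixes 2143.\<close>

lemma rev_compl_contains:
  assumes p: "\<pi> permutes {1..n}"
  shows "contains_pattern n \<pi> [1, 2, 4, 3] \<Longrightarrow> contains_pattern n (rev_compl n \<pi>) [2, 1, 3, 4]"
    and "contains_pattern n \<pi> [2, 1, 3, 4] \<Longrightarrow> contains_pattern n (rev_compl n \<pi>) [1, 2, 4, 3]"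
    and "contains_pattern n \<pi> [2, 1, 4, 3] \<Longrightarrow> contains_pattern n (rev_compl n \<pi>) [2, 1, 4, 3]"
proof -
  define f where "f = (\<lambda>x. n + 1 - x)"
  have less: "rev_compl n \<pi> (f i) < rev_compl n \<pi> (f j) \<longleftrightarrow> \<pi> j < \<pi> i"
    if "1 \<le> i" "i \<le> n" "1 \<le> j" "j \<le> n" for i j
  proof -
    have "f i \<in> {1..n}" "f j \<in> {1..n}" "n + 1 - f i = i" "n + 1 - f j = j"
      using that unfolding f_def by auto
    then show ?thesis using rev_compl_less[OF p, of "f i" "f j"] by simp
  qed
  have pos: "1 \<le> f l \<and> f l < f k \<and> f k < f j \<and> f j < f i \<and> f i \<le> n"
    if "1 \<le> i \<and> i < j \<and> j < k \<and> k < l \<and> l \<le> n" for i j k l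
    using that unfolding f_def by auto
  show "contains_pattern n \<pi> [1, 2, 4, 3] \<Longrightarrow> contains_pattern n (rev_compl n \<pi>) [2, 1, 3, 4]"
    unfolding contains_1243 contains_2134
  proof (elim exE)
    fix i j k l assume h: "1 \<le> i \<and> i < j \<and> j < k \<and> k < l \<and> l \<le> n \<and> \<pi> i < \<pi> j \<and> \<pi> j < \<pi> l \<and> \<pi> l < \<pi> k"
    show "\<exists>i j k l. 1 \<le> i \<and> i < j \<and> j < k \<and> k < l \<and> l \<le> n \<and> rev_compl n \<pi> j < rev_compl n \<pi> i \<and>
      rev_compl n \<pi> i < rev_compl n \<pi> k \<and> rev_compl n \<pi> k < rev_compl n \<pi> l"
      using pos[of i j k l] less[of k l] less[of l j] less[of j i] h
      by (intro exI[of _ "f l"] exI[of _ "f k"] exI[of _ "f j"] exI[of _ "f i"]) simp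
  qed
  show "contains_pattern n \<pi> [2, 1, 3, 4] \<Longrightarrow> contains_pattern n (rev_compl n \<pi>) [1, 2, 4, 3]"
    unfolding contains_1243 contains_2134
  proof (elim exE)
    fix i j k l assume h: "1 \<le> i \<and> i < j \<and> j < k \<and> k < l \<and> l \<le> n \<and> \<pi> j < \<pi> i \<and> \<pi> i < \<pi> k \<and> \<pi> k < \<pi> l"
    show "\<exists>i j k l. 1 \<le> i \<and> i < j \<and> j < k \<and> k < l \<and> l \<le> n \<and> rev_compl n \<pi> i < rev_compl n \<pi> j \<and>
      rev_compl n \<pi> j < rev_compl n \<pi> l \<and> rev_compl n \<pi> l < rev_compl n \<pi> k"
      using pos[of i j k l] less[of l k] less[of k i] less[of i j] h
      by (intro exI[of _ "f l"] exI[of _ "f k"] exI[of _ "f j"] exI[of _ "f i"]) simp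
  qed
  show "contains_pattern n \<pi> [2, 1, 4, 3] \<Longrightarrow> contains_pattern n (rev_compl n \<pi>) [2, 1, 4, 3]"
    unfolding contains_2143
  proof (elim exE)
    fix i j k l assume h: "1 \<le> i \<and> i < j \<and> j < k \<and> k < l \<and> l \<le> n \<and> \<pi> j < \<pi> i \<and> \<pi> i < \<pi> l \<and> \<pi> l < \<pi> k"
    show "\<exists>i j k l. 1 \<le> i \<and> i < j \<and> j < k \<and> k < l \<and> l \<le> n \<and> rev_compl n \<pi> j < rev_compl n \<pi> i \<and>
      rev_compl n \<pi> i < rev_compl n \<pi> l \<and> rev_compl n \<pi> l < rev_compl n \<pi> k"
      using pos[of i j k l] less[of k l] less[of l i] less[of i j] h
      by (intro exI[of _ "f l"] exI[of _ "f k"] exI[of _ "f j"] exI[of _ "f i"]) simp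
  qed
qed

lemma card_AI_RAI:
  assumes n: "odd n" and \<tau>: "(\<tau>, \<tau>') \<in> {([1, 2, 4, 3], [2, 1, 3, 4]), ([2, 1, 4, 3], [2, 1, 4, 3])}"
  shows "card (AI_av n \<tau>) = card (RAI_av n \<tau>')"
proof -
  have c: "contains_pattern n (rev_compl n \<pi>) \<tau>' \<longleftrightarrow> contains_pattern n \<pi> \<tau>"
    if p: "\<pi> permutes {1..n}" for \<pi>
    using \<tau> rev_compl_contains[OF p] rev_compl_contains[OF rev_compl_permutes[OF p], unfolded rev_compl_rev_compl]
    by auto
  have i: "rev_compl n \<pi> = inv (rev_compl n \<pi>) \<longleftrightarrow> \<pi> = inv \<pi>" if p: "\<pi> permutes {1..n}" for \<pi>
    unfolding rev_compl_inv[OF p] by (metis rev_compl_rev_compl)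
  have m: "rev_compl n \<pi> \<in> RAI_av n \<tau>' \<longleftrightarrow> \<pi> \<in> AI_av n \<tau>" if p: "\<pi> permutes {1..n}" for \<pi>
    using p c[OF p] i[OF p] rev_compl_permutes[OF p] rev_compl_alternating[OF p n]
    unfolding AI_av_def RAI_av_def AI_def RAI_def by simp
  have "bij_betw (rev_compl n) (AI_av n \<tau>) (RAI_av n \<tau>')"
  proof (rule bij_betw_byWitness[where f' = "rev_compl n"])
    show "rev_compl n ` AI_av n \<tau> \<subseteq> RAI_av n \<tau>'" using m by (auto simp: AI_av_def AI_def)
    show "rev_compl n ` RAI_av n \<tau>' \<subseteq> AI_av n \<tau>"
    proof
      fix \<sigma> assume "\<sigma> \<in> rev_compl n ` RAI_av n \<tau>'"
      then obtain \<pi> where \<pi>: "\<pi> \<in> RAI_av n \<tau>'" "\<sigma> = rev_compl n \<pi>" by blast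
      then have "\<sigma> permutes {1..n}" using rev_compl_permutes by (auto simp: RAI_av_def RAI_def)
      then show "\<sigma> \<in> AI_av n \<tau>" using m[of \<sigma>] \<pi> by (simp add: rev_compl_rev_compl)
    qed
  qed (auto simp: rev_compl_rev_compl)
  then show ?thesis by (rule bij_betw_same_card)
qed

section \<open>Removal of the cycle formed by 1 and \<open>n - 1\<close>\<close>

lemma permutes_involution_iff:
  "\<pi> permutes S \<and> \<pi> = inv \<pi> \<longleftrightarrow> (\<forall>x. \<pi> (\<pi> x) = x) \<and> (\<forall>x. x \<notin> S \<longrightarrow> \<pi> x = x)"
proof
  assume "\<pi> permutes S \<and> \<pi> = inv \<pi>"
  then show "(\<forall>x. \<pi> (\<pi> x) = x) \<and> (\<forall>x. x \<notin> S \<longrightarrow> \<pi> x = x)"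
    by (metis permutes_inverses(1) permutes_not_in)
next
  assume h: "(\<forall>x. \<pi> (\<pi> x) = x) \<and> (\<forall>x. x \<notin> S \<longrightarrow> \<pi> x = x)"
  then have "\<pi> \<circ> \<pi> = id" by auto
  then have "inv \<pi> = \<pi>" by (rule inv_unique_comp) fact
  moreover have "\<pi> permutes S" unfolding permutes_def using h by metis
  ultimately show "\<pi> permutes S \<and> \<pi> = inv \<pi>" by simp
qed

text \<open>Let \<open>v\<close> be the position of 1, an even number. If \<open>v < n - 1\<close>,
  an earlier entry smaller than \<open>\<pi> (n - 1)\<close> would form 2134 with the entry 1 and
  the final ascent \<open>\<pi> (n - 1) < \<pi> n\<close>. So all entries before \<open>v\<close>
  exceed \<open>\<pi> (n - 1)\<close>, and 2 is among them, which forces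
  \<open>\<pi> (n - 1) = 1\<close>.\<close>

lemma RAI_2134_outer_cycle:
  assumes "\<pi> \<in> RAI_av n [2, 1, 3, 4]" and n: "odd n" "3 \<le> n"
  shows "\<pi> (n - 1) = 1" "\<pi> 1 = n - 1"
proof -
  have perm: "\<pi> permutes {1..n}" and alt: "reverse_alternating n \<pi>"
    and av: "\<not> contains_pattern n \<pi> [2, 1, 3, 4]" and "\<pi> = inv \<pi>"
    using assms unfolding RAI_av_def RAI_def by auto
  then have idem: "\<pi> (\<pi> x) = x" for x using permutes_involution_iff by metis
  have in1: "\<pi> x \<in> {1..n}" if "x \<in> {1..n}" for x using permutes_in_image[OF perm] that by blast
  have inj: "\<pi> x = \<pi> y \<Longrightarrow> x = y" for x y using idem by metis
  have alt': "\<pi> (i + 1) < \<pi> i \<longleftrightarrow> odd i" if "1 \<le> i" "i + 1 \<le> n" for i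
    using alt that unfolding reverse_alternating_def by blast
  define a where "a = \<pi> (n - 1)"
  define v where "v = \<pi> 1"
  have av1: "\<pi> a = n - 1" "\<pi> v = 1" unfolding a_def v_def by (rule idem)+
  have "n - 1 \<in> {1..n}" "1 \<in> {1..n}" using n by auto
  then have an: "1 \<le> a" "a \<le> n" and vn: "1 \<le> v" "v \<le> n" using in1[of "n - 1"] in1[of 1] unfolding a_def v_def by auto
  have ab: "a < \<pi> n" using alt'[of "n - 1"] inj[of "n - 1" n] n unfolding a_def by fastforce
  \<comment> \<open>An odd position is followed by a smaller entry, impossible for the entry 1, or
    it is the last one, where the final ascent excludes 1.\<close>
  have ev: "even v"
  proof (rule ccontr)
    assume o: "odd v"
    show False
    proof (cases "v = n")
      case True
      then show False using ab av1 an by simp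
    next
      case False
      then have "\<pi> (v + 1) < \<pi> v" using alt'[of v] o vn by simp
      then have "\<pi> (v + 1) = 0" using av1 by simp
      moreover have "v + 1 \<in> {1..n}" using False vn by simp
      ultimately show False using in1[of "v + 1"] by simp
    qed
  qed
  have "v = n - 1"
  proof (rule ccontr)
    assume "v \<noteq> n - 1"
    moreover have "v \<noteq> n" using ev n by auto
    ultimately have vlt: "v < n - 1" using vn by simp
    have big: "a < \<pi> x" if x: "1 \<le> x" "x < v" for x
    proof (rule ccontr)
      assume "\<not> a < \<pi> x"
      moreover have "\<pi> x \<noteq> a" using inj[of x "n - 1"] x vlt unfolding a_def by auto
      ultimately have "\<pi> x < a" by simp
      moreover have "\<pi> v < \<pi> x" using in1[of x] inj[of x v] x vn av1 by fastforce
      ultimately show False using av vlt x ab n unfolding contains_2134 a_def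
        by (elim notE) (intro exI[of _ x] exI[of _ v] exI[of _ "n - 1"] exI[of _ n], simp)
    qed
    have "v \<noteq> 1" using ev by auto
    then have v2: "2 \<le> v" using vn by simp
    then have av': "a < v" using big[of 1] unfolding v_def by simp
    \<comment> \<open>The entry 2 stands at position \<open>\<pi> 2\<close>, and the initial descent
      \<open>\<pi> 2 < \<pi> 1 = v\<close> puts it before \<open>v\<close>.\<close>
    have "\<pi> 2 < \<pi> 1" using alt'[of 1] n by (simp add: numeral_2_eq_2)
    then have lt: "\<pi> 2 < v" by (simp add: v_def)
    have pos: "1 \<le> \<pi> 2" using in1[of 2] n by simp
    have "a < 2" using big[OF pos lt] idem by simp
    then have "a = 1" using an by simp
    then show False using av1 a_def \<open>v \<noteq> n - 1\<close> idem v_def by metis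
  qed
  then show "\<pi> 1 = n - 1" "\<pi> (n - 1) = 1" using av1 v_def by auto
qed

text \<open>The increasing bijection from \<open>{1..M}\<close> onto \<open>{1..M + 2}\<close>
  without 1 and \<open>M + 1\<close>; \<open>shift_down\<close> is its inverse there.\<close>

definition shift_up :: "nat \<Rightarrow> nat \<Rightarrow> nat" where
  "shift_up M j = (if j = M then M + 2 else j + 1)"

definition shift_down :: "nat \<Rightarrow> nat \<Rightarrow> nat" where
  "shift_down M v = (if v = M + 2 then M else v - 1)"

definition drop_cycle :: "nat \<Rightarrow> (nat \<Rightarrow> nat) \<Rightarrow> nat \<Rightarrow> nat" where
  "drop_cycle M \<pi> j = (if j \<in> {1..M} then shift_down M (\<pi> (shift_up M j)) else j)"

definition add_cycle :: "nat \<Rightarrow> (nat \<Rightarrow> nat) \<Rightarrow> nat \<Rightarrow> nat" where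
  "add_cycle M \<tau> v = (if v = 1 then M + 1 else if v = M + 1 then 1
    else if v \<in> {1..M + 2} then shift_up M (\<tau> (shift_down M v)) else v)"

lemma shift_down_up: "j \<in> {1..M} \<Longrightarrow> shift_down M (shift_up M j) = j"
  by (auto simp: shift_down_def shift_up_def)

lemma shift_up_down: "v \<in> {1..M + 2} - {1, M + 1} \<Longrightarrow> shift_up M (shift_down M v) = v"
  by (auto simp: shift_down_def shift_up_def)

lemma shift_up_in: "j \<in> {1..M} \<Longrightarrow> shift_up M j \<in> {1..M + 2} - {1, M + 1}"
  by (auto simp: shift_up_def)

lemma shift_down_in: "1 \<le> M \<Longrightarrow> v \<in> {1..M + 2} - {1, M + 1} \<Longrightarrow> shift_down M v \<in> {1..M}"
  by (auto simp: shift_down_def)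

lemma shift_up_less: "i \<in> {1..M} \<Longrightarrow> j \<in> {1..M} \<Longrightarrow> shift_up M i < shift_up M j \<longleftrightarrow> i < j"
  by (auto simp: shift_up_def)

lemma shift_down_less:
  "v \<in> {1..M + 2} - {1, M + 1} \<Longrightarrow> w \<in> {1..M + 2} - {1, M + 1} \<Longrightarrow> shift_down M v < shift_down M w \<longleftrightarrow> v < w"
  by (auto simp: shift_down_def)

lemma contains_2134_transfer:
  assumes "\<And>i j. i \<in> S \<Longrightarrow> j \<in> S \<Longrightarrow> i < j \<Longrightarrow> s i < s j" "\<And>i. i \<in> S \<Longrightarrow> s i \<in> {1..n'}"
    and "\<And>i j. i \<in> S \<Longrightarrow> j \<in> S \<Longrightarrow> \<pi> i < \<pi> j \<Longrightarrow> \<pi>' (s i) < \<pi>' (s j)"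
    and "i \<in> S" "j \<in> S" "k \<in> S" "l \<in> S" "i < j" "j < k" "k < l" "\<pi> j < \<pi> i" "\<pi> i < \<pi> k" "\<pi> k < \<pi> l"
  shows "contains_pattern n' \<pi>' [2, 1, 3, 4]"
  unfolding contains_2134
  using assms(1)[of i j] assms(1)[of j k] assms(1)[of k l] assms(2)[of i] assms(2)[of l]
    assms(3)[of j i] assms(3)[of i k] assms(3)[of k l] assms(4-)
  by (intro exI[of _ "s i"] exI[of _ "s j"] exI[of _ "s k"] exI[of _ "s l"]) simp

text \<open>All remaining positions but the last move by one, which turns reverse alternation into
  alternation. The last moves from \<open>M + 2\<close> to \<open>M\<close>, past the deleted
  position \<open>M + 1\<close>, so the comparison of the last two entries is lost.\<close>

lemma drop_cycle_in:
  assumes \<pi>: "\<pi> \<in> RAI_av (M + 2) [2, 1, 3, 4]" and M: "odd M"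
  shows "drop_cycle M \<pi> \<in> {\<tau> \<in> invol_alt M (M - 1). \<not> contains_pattern M \<tau> [2, 1, 3, 4]}"
    and "add_cycle M (drop_cycle M \<pi>) = \<pi>"
proof -
  let ?\<tau> = "drop_cycle M \<pi>"
  let ?V = "{1..M + 2} - {1, M + 1}"
  have M1: "1 \<le> M" using M by (auto elim: oddE)
  have cyc: "\<pi> (M + 1) = 1" "\<pi> 1 = M + 1"
    using RAI_2134_outer_cycle[OF \<pi>] M by (auto elim: oddE)
  have perm: "\<pi> permutes {1..M + 2}" and alt: "reverse_alternating (M + 2) \<pi>"
    and av: "\<not> contains_pattern (M + 2) \<pi> [2, 1, 3, 4]" and "\<pi> = inv \<pi>"
    using \<pi> unfolding RAI_av_def RAI_def by auto
  then have idem: "\<pi> (\<pi> x) = x" for x using permutes_involution_iff by metis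
  have inV: "\<pi> x \<in> ?V" if "x \<in> ?V" for x
  proof -
    have "\<pi> x \<in> {1..M + 2}" using permutes_in_image[OF perm] that by blast
    moreover have "\<pi> x \<noteq> 1" "\<pi> x \<noteq> M + 1" using idem[of x] cyc that by auto
    ultimately show ?thesis by simp
  qed
  have val: "?\<tau> j = shift_down M (\<pi> (shift_up M j))" if "j \<in> {1..M}" for j
    using that by (simp add: drop_cycle_def)
  have in\<tau>: "?\<tau> j \<in> {1..M}" if "j \<in> {1..M}" for j
    unfolding val[OF that] by (intro shift_down_in[OF M1] inV shift_up_in that)
  have up: "shift_up M (?\<tau> j) = \<pi> (shift_up M j)" if "j \<in> {1..M}" for j
    unfolding val[OF that] by (intro shift_up_down inV shift_up_in that)
  have less: "?\<tau> i < ?\<tau> j \<longleftrightarrow> \<pi> (shift_up M i) < \<pi> (shift_up M j)" if "i \<in> {1..M}" "j \<in> {1..M}" for i j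
    unfolding val[OF that(1)] val[OF that(2)] by (intro shift_down_less inV shift_up_in that)
  have "?\<tau> (?\<tau> j) = j" for j
  proof (cases "j \<in> {1..M}")
    case True
    then show ?thesis using val[OF in\<tau>[OF True]] up[OF True] idem shift_down_up[OF True] by simp
  qed (auto simp: drop_cycle_def)
  then have "?\<tau> permutes {1..M} \<and> ?\<tau> = inv ?\<tau>"
    unfolding permutes_involution_iff by (auto simp: drop_cycle_def)
  moreover have "alternating (M - 1) ?\<tau>" unfolding alternating_def
  proof (intro allI impI)
    fix i assume i: "1 \<le> i \<and> i + 1 \<le> M - 1"
    then have "i \<in> {1..M}" "i + 1 \<in> {1..M}" "shift_up M i = i + 1" "shift_up M (i + 1) = i + 2"
      by (auto simp: shift_up_def)
    then have "?\<tau> i < ?\<tau> (i + 1) \<longleftrightarrow> \<pi> (i + 1) < \<pi> (i + 2)" using less[of i "i + 1"] by simp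
    also have "\<dots> \<longleftrightarrow> \<not> \<pi> (i + 2) < \<pi> (i + 1)"
      using permutes_inj[OF perm] by (auto simp: inj_eq not_less order_le_less)
    also have "\<dots> \<longleftrightarrow> odd i"
      using alt[unfolded reverse_alternating_def, rule_format, of "i + 1"] i by auto
    finally show "?\<tau> i < ?\<tau> (i + 1) \<longleftrightarrow> odd i" .
  qed
  moreover have "\<not> contains_pattern M ?\<tau> [2, 1, 3, 4]"
  proof
    assume "contains_pattern M ?\<tau> [2, 1, 3, 4]"
    then obtain i j k l where h: "1 \<le> i" "i < j" "j < k" "k < l" "l \<le> M"
      "?\<tau> j < ?\<tau> i" "?\<tau> i < ?\<tau> k" "?\<tau> k < ?\<tau> l" unfolding contains_2134 by blast
    then have "i \<in> {1..M}" "j \<in> {1..M}" "k \<in> {1..M}" "l \<in> {1..M}" by auto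
    then have "contains_pattern (M + 2) \<pi> [2, 1, 3, 4]"
      using contains_2134_transfer[of "{1..M}" "shift_up M" "M + 2" ?\<tau> \<pi> i j k l] shift_up_less less shift_up_in h by auto
    then show False using av by simp
  qed
  ultimately show "?\<tau> \<in> {\<tau> \<in> invol_alt M (M - 1). \<not> contains_pattern M \<tau> [2, 1, 3, 4]}"
    unfolding invol_alt_def by simp
  show "add_cycle M ?\<tau> = \<pi>"
  proof
    fix v
    show "add_cycle M ?\<tau> v = \<pi> v"
    proof (cases "v \<in> ?V")
      case True
      then show ?thesis
        using up[OF shift_down_in[OF M1 True]] shift_up_down[OF True] by (simp add: add_cycle_def)
    next
      case False
      then show ?thesis using cyc permutes_not_in[OF perm, of v] by (auto simp: add_cycle_def)
    qed
  qed
qed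

text \<open>The new dots take no part in a 2134: the entry \<open>M + 1\<close> at position 1 could
  only be its 2, but only one entry is larger; the entry 1 at position \<open>M + 1\<close> could
  only be its 1, but only one position follows.\<close>

lemma add_cycle_in:
  assumes \<tau>: "\<tau> \<in> invol_alt M (M - 1)" "\<not> contains_pattern M \<tau> [2, 1, 3, 4]" and M: "odd M"
  shows "add_cycle M \<tau> \<in> RAI_av (M + 2) [2, 1, 3, 4]"
    and "drop_cycle M (add_cycle M \<tau>) = \<tau>"
proof -
  let ?\<pi> = "add_cycle M \<tau>"
  let ?V = "{1..M + 2} - {1, M + 1}"
  have M1: "1 \<le> M" using M by (auto elim: oddE)
  have perm: "\<tau> permutes {1..M}" and alt: "alternating (M - 1) \<tau>" and "\<tau> = inv \<tau>"
    using \<tau>(1) unfolding invol_alt_def by auto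
  then have idem: "\<tau> (\<tau> x) = x" for x using permutes_involution_iff by metis
  have in\<tau>: "\<tau> x \<in> {1..M}" if "x \<in> {1..M}" for x using permutes_in_image[OF perm] that by blast
  have cyc: "?\<pi> 1 = M + 1" "?\<pi> (M + 1) = 1" using M1 by (auto simp: add_cycle_def)
  have val: "?\<pi> v = shift_up M (\<tau> (shift_down M v))" if "v \<in> ?V" for v
    using that by (simp add: add_cycle_def)
  have inV: "?\<pi> v \<in> ?V" if "v \<in> ?V" for v
    unfolding val[OF that] by (intro shift_up_in in\<tau> shift_down_in[OF M1] that)
  have down: "shift_down M (?\<pi> v) = \<tau> (shift_down M v)" if "v \<in> ?V" for v
    unfolding val[OF that] by (intro shift_down_up in\<tau> shift_down_in[OF M1] that)
  have less: "?\<pi> v < ?\<pi> w \<longleftrightarrow> \<tau> (shift_down M v) < \<tau> (shift_down M w)" if "v \<in> ?V" "w \<in> ?V" for v w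
    unfolding val[OF that(1)] val[OF that(2)] by (intro shift_up_less in\<tau> shift_down_in[OF M1] that)
  have out: "?\<pi> x = x" if "x \<notin> {1..M + 2}" for x using that M1 by (auto simp: add_cycle_def)
  have "?\<pi> (?\<pi> x) = x" for x
  proof (cases "x \<in> ?V")
    case True
    then show ?thesis using val[OF inV[OF True]] down[OF True] idem shift_up_down[OF True] by simp
  next
    case False
    then consider "x = 1" | "x = M + 1" | "x \<notin> {1..M + 2}" by auto
    then show ?thesis
    proof cases
      case 3
      show ?thesis unfolding out[OF 3] by (rule refl)
    qed (simp_all only: cyc)
  qed
  then have pi: "?\<pi> permutes {1..M + 2} \<and> ?\<pi> = inv ?\<pi>"
    unfolding permutes_involution_iff using out by blast
  have bounds: "1 < ?\<pi> v" "?\<pi> v \<noteq> M + 1" "?\<pi> v \<le> M + 2" if "v \<in> ?V" for v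
    using inV[OF that] by auto
  have ralt: "reverse_alternating (M + 2) ?\<pi>" unfolding reverse_alternating_def
  proof (intro allI impI)
    fix i assume i: "1 \<le> i \<and> i + 1 \<le> M + 2"
    consider "i = 1" "M = 1" | "i = 1" "2 \<le> M" | "2 \<le> i" "i + 1 \<le> M" | "i = M" "2 \<le> i" | "i = M + 1"
      using i M1 by linarith
    then show "?\<pi> (i + 1) < ?\<pi> i \<longleftrightarrow> odd i"
    proof cases
      case 1
      then show ?thesis using cyc by simp
    next
      case 2
      then have M3: "3 \<le> M" using M by (cases "M = 2") auto
      then have two: "2 \<in> ?V" by simp
      \<comment> \<open>With \<open>\<tau> 2 \<le> M\<close> this excludes
        \<open>\<tau> 1 = M\<close>, the only value that \<open>shift_up\<close> sends above
        \<open>M + 1\<close>.\<close>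
      have "\<tau> 1 < \<tau> 2"
        using alt[unfolded alternating_def, rule_format, of 1] M3 by (simp add: numeral_2_eq_2)
      moreover have "\<tau> 2 \<le> M" using in\<tau>[of 2] M3 by simp
      ultimately have "?\<pi> 2 < M + 1" using val[OF two] M3 by (simp add: shift_down_def shift_up_def)
      then show ?thesis using 2 cyc by (simp add: numeral_2_eq_2)
    next
      case 3
      then have v: "i \<in> ?V" "i + 1 \<in> ?V" by auto
      have d: "shift_down M i = i - 1" "shift_down M (i + 1) = i - 1 + 1" using 3 by (auto simp: shift_down_def)
      have i1: "1 \<le> i - 1 \<and> i - 1 + 1 \<le> M - 1" using 3 by linarith
      have "?\<pi> (i + 1) \<noteq> ?\<pi> i" using pi permutes_inj[of ?\<pi>] by (auto simp: inj_eq)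
      then have "?\<pi> (i + 1) < ?\<pi> i \<longleftrightarrow> \<not> ?\<pi> i < ?\<pi> (i + 1)" by auto
      also have "\<dots> \<longleftrightarrow> \<not> \<tau> (i - 1) < \<tau> (i - 1 + 1)" using less[OF v] d by simp
      also have "\<dots> \<longleftrightarrow> odd i"
        using alt[unfolded alternating_def, rule_format, OF i1] 3 by simp
      finally show ?thesis .
    next
      case 4
      then have "1 < ?\<pi> M" by (intro bounds) auto
      then show ?thesis using 4 cyc M by simp
    next
      case 5
      then have "1 < ?\<pi> (M + 2)" by (intro bounds) auto
      then show ?thesis using 5 cyc M by simp
    qed
  qed
  have av: "\<not> contains_pattern (M + 2) ?\<pi> [2, 1, 3, 4]"
  proof
    assume "contains_pattern (M + 2) ?\<pi> [2, 1, 3, 4]"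
    then obtain i j k l where h: "1 \<le> i" "i < j" "j < k" "k < l" "l \<le> M + 2"
      "?\<pi> j < ?\<pi> i" "?\<pi> i < ?\<pi> k" "?\<pi> k < ?\<pi> l" unfolding contains_2134 by blast
    have le: "?\<pi> x \<le> M + 2" "1 \<le> ?\<pi> x" if "1 \<le> x" "x \<le> M + 2" for x
      using pi permutes_in_image[of ?\<pi> "{1..M + 2}" x] that by auto
    have "i \<noteq> 1" using h le[of l] cyc by auto
    moreover have "j \<noteq> M + 1" using h by auto
    moreover have "i \<noteq> M + 1" using h by auto
    moreover have "k \<noteq> M + 1" using h cyc le[of j] by auto
    moreover have "l \<noteq> M + 1" using h cyc le[of j] by auto
    ultimately have "i \<in> ?V" "j \<in> ?V" "k \<in> ?V" "l \<in> ?V" using h by auto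
    then have "contains_pattern M \<tau> [2, 1, 3, 4]"
      using contains_2134_transfer[of ?V "shift_down M" M ?\<pi> \<tau> i j k l] shift_down_less less shift_down_in[OF M1] h by blast
    then show False using \<tau>(2) by simp
  qed
  show "?\<pi> \<in> RAI_av (M + 2) [2, 1, 3, 4]" using pi ralt av unfolding RAI_av_def RAI_def by simp
  show "drop_cycle M ?\<pi> = \<tau>"
  proof
    fix j
    show "drop_cycle M ?\<pi> j = \<tau> j"
    proof (cases "j \<in> {1..M}")
      case True
      then show ?thesis using down[OF shift_up_in[OF True]] shift_down_up[OF True] by (simp add: drop_cycle_def)
    next
      case False
      then show ?thesis using permutes_not_in[OF perm False] unfolding drop_cycle_def by auto
    qed
  qed
qed

lemma card_RAI_2134:
  assumes "odd M"
  shows "card (RAI_av (M + 2) [2, 1, 3, 4]) = card {\<tau> \<in> invol_alt M (M - 1). \<not> contains_pattern M \<tau> [2, 1, 3, 4]}"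
proof (rule bij_betw_same_card, rule bij_betw_byWitness[where f = "drop_cycle M" and f' = "add_cycle M"])
qed (use drop_cycle_in[OF _ assms] add_cycle_in[OF _ _ assms] in auto)

section \<open>Robinson-Schensted correspondence for involutions\<close>

text \<open>The local rule for two equal labels: boxes added in the same row \<open>c\<close> are
  followed by one in row \<open>c + 1\<close>; no box, coded by 0, is followed by none.\<close>

definition bump :: "nat \<Rightarrow> nat" where
  "bump c = (if c = 0 then 0 else c + 1)"

text \<open>\<open>label \<pi> i j\<close> is attached to the edge from \<open>(i - 1, j)\<close> to \<open>(i, j)\<close> in Fomin's growth diagram of
  the involution \<open>\<pi>\<close>: it is the number of the row, counted from 1, of the box added along this edge,
  or 0 if no box is added. As the diagram is symmetric, the edge from \<open>(i, j - 1)\<close> to \<open>(i, j)\<close>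
  carries \<open>label \<pi> j i\<close>.\<close>

function (sequential) label :: "(nat \<Rightarrow> nat) \<Rightarrow> nat \<Rightarrow> nat \<Rightarrow> nat" where
  "label \<pi> i 0 = 0"
| "label \<pi> 0 (Suc j) = 0"
| "label \<pi> (Suc i) (Suc j) = (if \<pi> (Suc i) = Suc j then 1
     else if label \<pi> (Suc i) j = label \<pi> (Suc j) i then bump (label \<pi> (Suc i) j)
     else label \<pi> (Suc i) j)"
  by pat_completeness auto
termination by (relation "measure (\<lambda>(\<pi>, i, j). i + j)") auto

text \<open>The same labels, recovered from those on the outer boundary; here the coordinates \<open>(a, b)\<close> stand
  for \<open>(n - a, n - b)\<close>.\<close>

function unlabel :: "(nat \<Rightarrow> nat) \<Rightarrow> nat \<Rightarrow> nat \<Rightarrow> nat" where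
  "unlabel u a 0 = u a"
| "unlabel u a (Suc b) = (if unlabel u a b = unlabel u b a then unlabel u a b - 1 else unlabel u a b)"
  by pat_completeness auto
termination by (relation "measure (\<lambda>(u, a, b). a + b)") auto

text \<open>The labels along the line at height \<open>j\<close>, read from the right end at
  \<open>i\<close> to the left. The shape at \<open>(i, j)\<close> has as many boxes in row
  \<open>c\<close> as the word has letters \<open>c\<close>.\<close>

fun row :: "(nat \<Rightarrow> nat) \<Rightarrow> nat \<Rightarrow> nat \<Rightarrow> nat list" where
  "row \<pi> 0 j = []"
| "row \<pi> (Suc i) j = label \<pi> (Suc i) j # row \<pi> i j"

text \<open>Words are written backwards: the head of the list is the last letter. The letter 0 is neutral.\<close>

fun ballot :: "nat list \<Rightarrow> bool" where
  "ballot [] \<longleftrightarrow> True"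
| "ballot (x # xs) \<longleftrightarrow> (1 < x \<longrightarrow> count_list xs x < count_list xs (x - 1)) \<and> ballot xs"

lemma ballot_antimono: "ballot xs \<Longrightarrow> 1 \<le> c \<Longrightarrow> count_list xs (Suc c) \<le> count_list xs c"
  by (induction xs) auto

lemma ballot_drop: "ballot xs \<Longrightarrow> ballot (drop b xs)"
  by (induction xs arbitrary: b) (auto simp: drop_Cons split: nat.split)

locale involution =
  fixes \<pi> :: "nat \<Rightarrow> nat"
  assumes invol [simp]: "\<pi> (\<pi> x) = x" and pos: "1 \<le> x \<Longrightarrow> 1 \<le> \<pi> x"
begin

lemma invol_swap: "\<pi> x = y \<longleftrightarrow> \<pi> y = x"
  by (metis invol)

text \<open>The local rule keeps 0 at 0 and positive labels positive; only the dot of column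
  \<open>Suc i\<close> turns 0 into 1.\<close>

lemma label_eq_0: "label \<pi> (Suc i) j = 0 \<longleftrightarrow> j < \<pi> (Suc i)"
proof (induction j)
  case 0
  then show ?case using pos[of "Suc i"] by simp
next
  case (Suc j)
  then show ?case by (auto simp: bump_def)
qed

text \<open>The local rule read from the outer edges to the inner ones. Truncated subtraction covers
  all cases of equal labels: \<open>c + 1\<close> comes from \<open>c\<close>, where 1 comes from 0
  at a dot, and 0 stays 0.\<close>

lemma label_square:
  "\<pi> (Suc i) = Suc j \<longleftrightarrow> label \<pi> (Suc i) (Suc j) = 1 \<and> label \<pi> (Suc j) (Suc i) = 1"
  "label \<pi> (Suc i) j = (if label \<pi> (Suc i) (Suc j) = label \<pi> (Suc j) (Suc i)
     then label \<pi> (Suc i) (Suc j) - 1 else label \<pi> (Suc i) (Suc j))"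
proof -
  have x: "\<pi> (Suc i) = Suc j \<longleftrightarrow> \<pi> (Suc j) = Suc i" by (rule invol_swap)
  then have z: "\<pi> (Suc i) = Suc j \<Longrightarrow> label \<pi> (Suc i) j = 0 \<and> label \<pi> (Suc j) i = 0"
    by (simp add: label_eq_0)
  show "\<pi> (Suc i) = Suc j \<longleftrightarrow> label \<pi> (Suc i) (Suc j) = 1 \<and> label \<pi> (Suc j) (Suc i) = 1"
    using x by (auto simp: bump_def)
  show "label \<pi> (Suc i) j = (if label \<pi> (Suc i) (Suc j) = label \<pi> (Suc j) (Suc i)
     then label \<pi> (Suc i) (Suc j) - 1 else label \<pi> (Suc i) (Suc j))"
    using x z by (auto simp: bump_def)
qed

lemma label_eq_unlabel:
  assumes "\<And>a. a < n \<Longrightarrow> u a = label \<pi> (n - a) n"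
  shows "a < n \<Longrightarrow> b \<le> n \<Longrightarrow> label \<pi> (n - a) (n - b) = unlabel u a b"
  using assms
proof (induction u a b rule: unlabel.induct)
  case (1 u a)
  then show ?case by simp
next
  case (2 u a b)
  define i j where "i = n - Suc a" and "j = n - Suc b"
  have ij: "n - a = Suc i" "n - b = Suc j" "n - Suc b = j"
    using "2.prems"(1,2) unfolding i_def j_def by auto
  have "label \<pi> (n - a) (n - b) = unlabel u a b" "label \<pi> (n - b) (n - a) = unlabel u b a"
    using 2(1)[OF "2.prems"(1) _ "2.prems"(3)] 2(2)[OF _ _ "2.prems"(3)] "2.prems"(1,2) by simp_all
  then show ?case using label_square(2)[of i j] ij by simp
qed

text \<open>Moving up one level, the shape at \<open>k\<close> gains the box of the vertical edge,
  which by symmetry is labelled \<open>label \<pi> (Suc j) k\<close>. The induction carries this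
  count along because the ballot property of the new line depends on it.\<close>

lemma row_Suc:
  assumes "\<And>k. ballot (row \<pi> k j)"
  shows "ballot (row \<pi> k (Suc j)) \<and>
    (\<forall>x\<ge>1. count_list (row \<pi> k (Suc j)) x = count_list (row \<pi> k j) x + (if x = label \<pi> (Suc j) k then 1 else 0))"
proof (induction k)
  case 0
  then show ?case by simp
next
  case (Suc k)
  have x: "\<pi> (Suc k) = Suc j \<longleftrightarrow> \<pi> (Suc j) = Suc k" by (rule invol_swap)
  let ?b = "label \<pi> (Suc k) j" and ?l = "label \<pi> (Suc j) k"
  have b: "1 < ?b \<longrightarrow> count_list (row \<pi> k j) ?b < count_list (row \<pi> k j) (?b - 1)"
    using assms[of "Suc k"] by simp
  have anti: "1 \<le> c \<Longrightarrow> count_list (row \<pi> k j) (Suc c) \<le> count_list (row \<pi> k j) c" for c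
    using ballot_antimono assms by blast
  have IH: "ballot (row \<pi> k (Suc j))"
    "x \<ge> 1 \<Longrightarrow> count_list (row \<pi> k (Suc j)) x = count_list (row \<pi> k j) x + (if x = ?l then 1 else 0)" for x
    using Suc by auto
  show ?case
  proof (cases "\<pi> (Suc k) = Suc j")
    case True
    then have "?b = 0" "?l = 0" using x by (simp_all add: label_eq_0)
    then show ?thesis using True x IH by auto
  next
    case False
    show ?thesis
    proof (cases "?b = ?l")
      case True
      \<comment> \<open>The box of the vertical edge lengthens row \<open>?l\<close>, which leaves
        room for the bumped box below it.\<close>
      then show ?thesis using False x IH anti[of ?l] by (auto simp: bump_def)
    next
      case neq: False
      have "1 < ?b \<longrightarrow> count_list (row \<pi> k (Suc j)) ?b < count_list (row \<pi> k (Suc j)) (?b - 1)"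
        using b neq IH(2)[of ?b] IH(2)[of "?b - 1"] by auto
      then show ?thesis using False neq x IH by auto
    qed
  qed
qed

lemma ballot_row: "ballot (row \<pi> k j)"
proof (induction j arbitrary: k)
  case 0
  show ?case by (induction k) auto
qed (use row_Suc in blast)

lemma count_row_Suc:
  "1 \<le> x \<Longrightarrow> count_list (row \<pi> k (Suc j)) x = count_list (row \<pi> k j) x + (if x = label \<pi> (Suc j) k then 1 else 0)"
  using row_Suc[OF ballot_row] by blast

section \<open>Increasing subsequences and the first row\<close>

text \<open>An increasing sequence of \<open>k\<close> dots in the rectangle
  \<open>{1..i} \<times> {1..j}\<close>, its last dot first.\<close>

fun chain :: "nat \<Rightarrow> nat \<Rightarrow> nat \<Rightarrow> bool" where
  "chain 0 i j \<longleftrightarrow> True"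
| "chain (Suc k) i j \<longleftrightarrow> (\<exists>a. 1 \<le> a \<and> a \<le> i \<and> \<pi> a \<le> j \<and> chain k (a - 1) (\<pi> a - 1))"

lemma chain_Suc_Suc:
  "chain (Suc k) (Suc i) (Suc j) \<longleftrightarrow>
    chain (Suc k) i (Suc j) \<or> chain (Suc k) (Suc i) j \<or> \<pi> (Suc i) = Suc j \<and> chain k i j"
proof
  assume "chain (Suc k) (Suc i) (Suc j)"
  then obtain a where a: "1 \<le> a" "a \<le> Suc i" "\<pi> a \<le> Suc j" "chain k (a - 1) (\<pi> a - 1)" by auto
  then consider "a \<le> i" | "\<pi> a \<le> j" | "a = Suc i" "\<pi> a = Suc j" by linarith
  then show "chain (Suc k) i (Suc j) \<or> chain (Suc k) (Suc i) j \<or> \<pi> (Suc i) = Suc j \<and> chain k i j"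
    using a by cases auto
next
  assume "chain (Suc k) i (Suc j) \<or> chain (Suc k) (Suc i) j \<or> \<pi> (Suc i) = Suc j \<and> chain k i j"
  then show "chain (Suc k) (Suc i) (Suc j)"
    by (auto intro: le_SucI)
qed

text \<open>Schensted's theorem: the first row is as long as a longest increasing subsequence. Both
  lengths obey one recursion at the corner \<open>(i, j)\<close>: with a dot there, the diagonal
  neighbour's value grows by one; otherwise the larger value of the two adjacent corners is
  taken.\<close>

lemma chain_iff_count: "chain k i j \<longleftrightarrow> k \<le> count_list (row \<pi> i j) 1"
proof (induction "i + j" arbitrary: i j k rule: less_induct)
  case less
  \<comment> \<open>First-row lengths: \<open>c\<close> at the corner, \<open>a\<close> and
    \<open>b\<close> at its neighbours. Unless both edges into the corner add to row 1, one
    neighbour already has length \<open>c\<close>.\<close>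
  have arith: "c = b + (if 1 = r then 1 else 0) \<Longrightarrow> c = a + (if 1 = t then 1 else 0) \<Longrightarrow>
    \<not> (t = 1 \<and> r = 1) \<Longrightarrow> c = max a b" for a b c r t :: nat
    by (auto split: if_splits)
  show ?case
  proof (cases k)
    case 0
    then show ?thesis by simp
  next
    case (Suc k')
    show ?thesis
    proof (cases "i = 0 \<or> j = 0")
      case True
      have "count_list (row \<pi> i 0) 1 = 0" by (induction i) auto
      moreover have "\<not> chain (Suc k') i 0" using pos by fastforce
      ultimately show ?thesis using True Suc by auto
    next
      case False
      then obtain i' j' where ij: "i = Suc i'" "j = Suc j'" by (metis not0_implies_Suc)
      let ?L = "\<lambda>i j. count_list (row \<pi> i j) 1"
      have x: "\<pi> (Suc i') = Suc j' \<longleftrightarrow> \<pi> (Suc j') = Suc i'" by (rule invol_swap)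
      have IH: "chain k i' (Suc j') \<longleftrightarrow> k \<le> ?L i' (Suc j')" "chain k (Suc i') j' \<longleftrightarrow> k \<le> ?L (Suc i') j'"
        "chain k' i' j' \<longleftrightarrow> k' \<le> ?L i' j'"
        using less ij by auto
      have L1: "?L (Suc i') (Suc j') = ?L (Suc i') j' + (if 1 = label \<pi> (Suc j') (Suc i') then 1 else 0)"
        "?L i' (Suc j') = ?L i' j' + (if 1 = label \<pi> (Suc j') i' then 1 else 0)"
        using count_row_Suc by blast+
      have L2: "?L (Suc i') (Suc j') = ?L i' (Suc j') + (if 1 = label \<pi> (Suc i') (Suc j') then 1 else 0)"
        "?L (Suc i') j' = ?L i' j' + (if 1 = label \<pi> (Suc i') j' then 1 else 0)"
        by auto
      have z: "\<pi> (Suc i') = Suc j' \<Longrightarrow> label \<pi> (Suc i') j' = 0 \<and> label \<pi> (Suc j') i' = 0"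
        using x by (simp add: label_eq_0)
      have "chain (Suc k') (Suc i') (Suc j') \<longleftrightarrow> Suc k' \<le> ?L (Suc i') (Suc j')"
      proof (cases "\<pi> (Suc i') = Suc j'")
        case True
        then have "label \<pi> (Suc j') (Suc i') = 1" using x by simp
        then have "?L (Suc i') (Suc j') = Suc (?L i' j')" "?L i' (Suc j') = ?L i' j'" "?L (Suc i') j' = ?L i' j'"
          using L1 L2 z[OF True] by auto
        then show ?thesis unfolding chain_Suc_Suc using IH True Suc by auto
      next
        case False
        then have "\<not> (label \<pi> (Suc i') (Suc j') = 1 \<and> label \<pi> (Suc j') (Suc i') = 1)"
          using label_square(1)[of i' j'] by blast
        then have "?L (Suc i') (Suc j') = max (?L i' (Suc j')) (?L (Suc i') j')"
          using arith[OF L1(1) L2(1)] by blast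
        then show ?thesis
          unfolding chain_Suc_Suc using IH(1,2)[unfolded Suc] False by (simp only: le_max_iff_disj simp_thms)
      qed
      then show ?thesis using ij Suc by simp
    qed
  qed
qed

section \<open>Ascents and descents seen in the labels\<close>

text \<open>Above both dots let the labels be \<open>x\<close> and \<open>y\<close> from left to
  right, and let a vertical label come in from the left. If it equals \<open>x\<close>, it leaves
  the first square as \<open>x + 1\<close> and \<open>y \<le> x\<close> is untouched; if it equals
  \<open>y < x\<close>, only \<open>y\<close> grows, to at most \<open>x\<close>.\<close>

lemma label_ascent:
  assumes "\<pi> (Suc i) < \<pi> (Suc (Suc i))" "\<pi> (Suc (Suc i)) \<le> j"
  shows "label \<pi> (Suc (Suc i)) j \<le> label \<pi> (Suc i) j"
  using assms(2)
proof (induction j)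
  case 0
  then show ?case by simp
next
  case (Suc j)
  have ne: "\<pi> (Suc i) \<noteq> Suc j" using assms(1) Suc.prems by simp
  have pos1: "label \<pi> (Suc i) j \<noteq> 0" using assms(1) Suc.prems by (simp add: label_eq_0)
  show ?case
  proof (cases "\<pi> (Suc (Suc i)) = Suc j")
    case True
    then have "1 \<le> label \<pi> (Suc i) (Suc j)" using label_eq_0[of i "Suc j"] assms(1) by linarith
    then show ?thesis using True by simp
  next
    case False
    then have le: "label \<pi> (Suc (Suc i)) j \<le> label \<pi> (Suc i) j" using Suc by simp
    have nz: "\<pi> (Suc j) \<noteq> Suc i" "\<pi> (Suc j) \<noteq> Suc (Suc i)" using ne False invol_swap by metis+
    show ?thesis using le ne False nz pos1 by (auto simp: bump_def)
  qed
qed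

text \<open>With labels \<open>x < y\<close> of the two columns, an incoming vertical label
  \<open>x\<close> leaves the first square as \<open>x + 1\<close>; when \<open>y = x + 1\<close>,
  it therefore raises \<open>y\<close> as well.\<close>

lemma label_descent:
  assumes "\<pi> (Suc (Suc i)) < \<pi> (Suc i)" "\<pi> (Suc i) \<le> j"
  shows "label \<pi> (Suc i) j < label \<pi> (Suc (Suc i)) j"
  using assms(2)
proof (induction j)
  case 0
  then show ?case using pos[of "Suc i"] by simp
next
  case (Suc j)
  have ne: "\<pi> (Suc (Suc i)) \<noteq> Suc j" using assms(1) Suc.prems by simp
  have pos1: "label \<pi> (Suc (Suc i)) j \<noteq> 0" using assms(1) Suc.prems by (simp add: label_eq_0)
  show ?case
  proof (cases "\<pi> (Suc i) = Suc j")
    case True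
    then have "\<pi> (Suc j) = Suc i" using invol_swap by blast
    then show ?thesis using True ne pos1 by (auto simp: bump_def)
  next
    case False
    then have le: "label \<pi> (Suc i) j < label \<pi> (Suc (Suc i)) j" using Suc by simp
    have nz: "\<pi> (Suc j) \<noteq> Suc i" "\<pi> (Suc j) \<noteq> Suc (Suc i)" using ne False invol_swap by metis+
    show ?thesis using le ne False nz pos1 by (auto simp: bump_def)
  qed
qed

lemma label_ascent_iff:
  assumes "\<pi> (Suc i) \<le> j" "\<pi> (Suc (Suc i)) \<le> j"
  shows "label \<pi> (Suc (Suc i)) j \<le> label \<pi> (Suc i) j \<longleftrightarrow> \<pi> (Suc i) < \<pi> (Suc (Suc i))"
proof -
  have "\<pi> (Suc i) \<noteq> \<pi> (Suc (Suc i))" by (metis invol n_not_Suc_n)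
  then show ?thesis using label_ascent[OF _ assms(2)] label_descent[OF _ assms(1)] by (meson leD linorder_neqE_nat)
qed

end

section \<open>The bijection between involutions and ballot words\<close>

definition involutions :: "nat \<Rightarrow> (nat \<Rightarrow> nat) set" where
  "involutions n = {\<pi>. (\<forall>x. \<pi> (\<pi> x) = x) \<and> (\<forall>x. x \<notin> {1..n} \<longrightarrow> \<pi> x = x)}"

definition ballot_words :: "nat \<Rightarrow> nat list set" where
  "ballot_words n = {w. length w = n \<and> ballot w \<and> 0 \<notin> set w}"

lemma involutions_in: "\<pi> \<in> involutions n \<Longrightarrow> x \<in> {1..n} \<Longrightarrow> \<pi> x \<in> {1..n}"
proof (rule ccontr)
  assume \<pi>: "\<pi> \<in> involutions n" and x: "x \<in> {1..n}" and n: "\<pi> x \<notin> {1..n}"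
  then have "\<pi> (\<pi> x) = x" "\<pi> (\<pi> x) = \<pi> x" unfolding involutions_def by blast+
  then show False using x n by simp
qed

lemma involution_locale: "\<pi> \<in> involutions n \<Longrightarrow> involution \<pi>"
proof
  fix x assume \<pi>: "\<pi> \<in> involutions n"
  then show "\<pi> (\<pi> x) = x" by (simp add: involutions_def)
  assume "1 \<le> x"
  show "1 \<le> \<pi> x"
  proof (cases "x \<in> {1..n}")
    case True
    then show ?thesis using involutions_in[OF \<pi>] by auto
  next
    case False
    then show ?thesis using \<pi> \<open>1 \<le> x\<close> by (simp add: involutions_def)
  qed
qed

lemma length_row: "length (row \<pi> n j) = n"
  by (induction n) auto

lemma nth_row: "a < n \<Longrightarrow> row \<pi> n j ! a = label \<pi> (n - a) j"
  by (induction n arbitrary: a) (auto simp: nth_Cons Suc_diff_Suc simp del: label.simps split: nat.split)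

lemma row_in_ballot_words:
  assumes \<pi>: "\<pi> \<in> involutions n"
  shows "row \<pi> n n \<in> ballot_words n"
proof -
  interpret involution \<pi> using \<pi> by (rule involution_locale)
  have "row \<pi> n n ! a \<noteq> 0" if a: "a < n" for a
  proof -
    have s: "n - a = Suc (n - Suc a)" using a by simp
    have "\<pi> (n - a) \<in> {1..n}" using a by (intro involutions_in[OF \<pi>]) auto
    then show ?thesis using a label_eq_0[of "n - Suc a" n] unfolding nth_row[OF a] s by simp
  qed
  then show ?thesis unfolding ballot_words_def using ballot_row by (auto simp: length_row in_set_conv_nth)
qed

text \<open>The word gives the labels on the boundary, these give all labels by
  \<open>unlabel\<close>, and the squares with two outer labels 1 contain the dots.\<close>

lemma row_inj: "inj_on (\<lambda>\<pi>. row \<pi> n n) (involutions n)"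
proof (rule inj_onI)
  fix \<pi> \<sigma> assume \<pi>: "\<pi> \<in> involutions n" and \<sigma>: "\<sigma> \<in> involutions n" and eq: "row \<pi> n n = row \<sigma> n n"
  interpret p: involution \<pi> using \<pi> by (rule involution_locale)
  interpret s: involution \<sigma> using \<sigma> by (rule involution_locale)
  let ?u = "\<lambda>a. label \<pi> (n - a) n"
  have u: "a < n \<Longrightarrow> ?u a = label \<sigma> (n - a) n" for a using nth_row[of a n \<pi> n] nth_row[of a n \<sigma> n] eq by simp
  have lab: "label \<pi> (n - a) (n - b) = label \<sigma> (n - a) (n - b)" if "a < n" "b \<le> n" for a b
    using p.label_eq_unlabel[of n ?u a b] s.label_eq_unlabel[of n ?u a b] u that by simp
  have lab': "label \<pi> (Suc i) (Suc j) = label \<sigma> (Suc i) (Suc j)" if "Suc i \<le> n" "Suc j \<le> n" for i j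
    using lab[of "n - Suc i" "n - Suc j"] that by simp
  have imp: "\<pi> x = y \<longleftrightarrow> \<sigma> x = y" if xy: "x \<in> {1..n}" "y \<in> {1..n}" for x y
  proof -
    obtain i j where ij: "x = Suc i" "y = Suc j" using xy by (metis atLeastAtMost_iff not0_implies_Suc not_one_le_zero)
    then show ?thesis using p.label_square(1)[of i j] s.label_square(1)[of i j] lab'[of i j] lab'[of j i] xy by simp
  qed
  show "\<pi> = \<sigma>"
  proof
    fix x show "\<pi> x = \<sigma> x"
      using imp[of x "\<pi> x"] involutions_in[OF \<pi>, of x] \<pi> \<sigma> by (cases "x \<in> {1..n}") (auto simp: involutions_def)
  qed
qed

text \<open>One level of \<open>unlabel\<close>, traversed from right to left as in reverse row
  insertion: \<open>c\<close> is the vertical label entering the current square, and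
  \<open>unlabel_carry\<close> gives the one leaving the last square.\<close>

fun unlabel_row :: "nat \<Rightarrow> nat list \<Rightarrow> nat list" where
  "unlabel_row c [] = []"
| "unlabel_row c (t # ts) = (if t = c then t - 1 else t) # unlabel_row (if t = c then c - 1 else c) ts"

fun unlabel_carry :: "nat \<Rightarrow> nat list \<Rightarrow> nat" where
  "unlabel_carry c [] = c"
| "unlabel_carry c (t # ts) = unlabel_carry (if t = c then c - 1 else c) ts"

text \<open>The carry is 0 or the row of a removable corner of the shape at the current point. At
  the left end the shape is empty, so the carry must have become 0.\<close>

lemma unlabel_row_correct:
  assumes "ballot ts" "c = 0 \<or> count_list ts (Suc c) < count_list ts c"
  shows "unlabel_carry c ts = 0 \<and> ballot (unlabel_row c ts) \<and>
    (\<forall>x\<ge>1. count_list (unlabel_row c ts) x + (if x = c then 1 else 0) = count_list ts x)"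
  using assms
proof (induction ts arbitrary: c)
  case Nil
  then show ?case by simp
next
  case (Cons t ts)
  have anti: "1 \<le> d \<Longrightarrow> count_list ts (Suc d) \<le> count_list ts d" for d
    using ballot_antimono Cons.prems(1) by simp
  have tb: "1 < t \<longrightarrow> count_list ts t < count_list ts (t - 1)" "ballot ts" using Cons.prems(1) by auto
  show ?case
  proof (cases "t = c")
    case neq: False
    then have pre: "c = 0 \<or> count_list ts (Suc c) < count_list ts c" using Cons.prems(2) by (auto split: if_splits)
    note IH = Cons.IH[OF tb(2) pre]
    then have cnt: "x \<ge> 1 \<Longrightarrow> count_list (unlabel_row c ts) x + (if x = c then 1 else 0) = count_list ts x" for x by blast
    have "1 < t \<longrightarrow> count_list (unlabel_row c ts) t < count_list (unlabel_row c ts) (t - 1)"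
    proof
      assume t: "1 < t"
      then have t1: "1 \<le> t - 1" by simp
      \<comment> \<open>When row \<open>t - 1\<close> loses a box, the corner condition for
        \<open>t # ts\<close> guarantees that it stays longer than row \<open>t\<close> of
        \<open>ts\<close>.\<close>
      from t have "t - 1 = c \<longrightarrow> count_list ts t + 1 < count_list ts (t - 1)" using Cons.prems(2) neq by (auto split: if_splits)
      then show "count_list (unlabel_row c ts) t < count_list (unlabel_row c ts) (t - 1)"
        using cnt[of t] cnt[OF t1] t tb(1) neq by (cases "t - 1 = c") auto
    qed
    then show ?thesis using IH neq by auto
  next
    case eq: True
    \<comment> \<open>The new carry \<open>c - 1\<close> is a corner of the shape of
      \<open>ts\<close>, because the letter \<open>c\<close> could be added below it.\<close>
    have pre: "c - 1 = 0 \<or> count_list ts (Suc (c - 1)) < count_list ts (c - 1)" using tb(1) eq by (cases c) auto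
    note IH = Cons.IH[OF tb(2) pre]
    then have cnt: "x \<ge> 1 \<Longrightarrow> count_list (unlabel_row (c - 1) ts) x + (if x = c - 1 then 1 else 0) = count_list ts x" for x by blast
    have "1 < c - 1 \<longrightarrow> count_list (unlabel_row (c - 1) ts) (c - 1) < count_list (unlabel_row (c - 1) ts) (c - 1 - 1)"
    proof
      assume "1 < c - 1"
      then obtain d where d: "c = Suc (Suc d)" "1 \<le> d" 
        by (cases c; cases "c - 1") auto
      show "count_list (unlabel_row (c - 1) ts) (c - 1) < count_list (unlabel_row (c - 1) ts) (c - 1 - 1)"
        using cnt[of "Suc d"] cnt[OF d(2)] anti[OF d(2)] unfolding d(1) by simp
    qed
    moreover have "count_list (unlabel_row c (t # ts)) x + (if x = c then 1 else 0) = count_list (t # ts) x" if "x \<ge> 1" for x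
      using cnt[OF that] eq that by auto
    ultimately show ?thesis using IH eq by auto
  qed
qed

lemma unlabel_row_map:
  "unlabel_row (unlabel u b k) (map (\<lambda>a. unlabel u a b) [k..<k + n]) = map (\<lambda>a. unlabel u a (Suc b)) [k..<k + n]"
proof (induction n arbitrary: k)
  case (Suc n k)
  have e: "[k..<k + Suc n] = k # [Suc k..<Suc k + n]" by (simp add: upt_conv_Cons)
  show ?case unfolding e using Suc.IH[of "Suc k"] by (auto simp del: upt_Suc)
qed simp

lemma unlabel_carry_map:
  "unlabel_carry (unlabel u b k) (map (\<lambda>a. unlabel u a b) [k..<k + n]) = unlabel u b (k + n)"
proof (induction n arbitrary: k)
  case (Suc n k)
  have e: "[k..<k + Suc n] = k # [Suc k..<Suc k + n]" by (simp add: upt_conv_Cons)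
  show ?case unfolding e using Suc.IH[of "Suc k"] by (auto simp del: upt_Suc)
qed simp

text \<open>Level \<open>b\<close> keeps the shape of \<open>drop b w\<close>. By symmetry its
  vertical boundary label is \<open>w ! b\<close>, a corner of that shape, so the next level is
  again a ballot word and the carry left at the far end is 0.\<close>

lemma unlabel_bottom:
  assumes w: "w \<in> ballot_words n" and b: "b < n"
  shows "unlabel ((!) w) b n = 0"
proof -
  let ?u = "(!) w"
  let ?r = "\<lambda>b. map (\<lambda>a. unlabel ?u a b) [0..<n]"
  have len: "length w = n" and bal: "ballot w" and nz: "0 \<notin> set w" using w by (auto simp: ballot_words_def)
  have step: "unlabel ?u b n = 0 \<and> ballot (?r (Suc b)) \<and> (\<forall>x\<ge>1. count_list (?r (Suc b)) x = count_list (drop (Suc b) w) x)"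
    if h: "b < n" "ballot (?r b)" "\<forall>x\<ge>1. count_list (?r b) x = count_list (drop b w) x" for b
  proof -
    have d: "drop b w = w ! b # drop (Suc b) w" using h(1) len by (simp add: Cons_nth_drop_Suc)
    have c: "1 \<le> w ! b" using nz h(1) len by (metis One_nat_def Suc_leI not_gr_zero nth_mem)
    have "count_list (drop (Suc b) w) (Suc (w ! b)) \<le> count_list (drop (Suc b) w) (w ! b)"
      using ballot_antimono[OF ballot_drop[OF bal] c] .
    then have "count_list (?r b) (Suc (w ! b)) < count_list (?r b) (w ! b)" using h(3) d c by simp
    then have *: "unlabel_carry (w ! b) (?r b) = 0 \<and> ballot (unlabel_row (w ! b) (?r b)) \<and>
      (\<forall>x\<ge>1. count_list (unlabel_row (w ! b) (?r b)) x + (if x = w ! b then 1 else 0) = count_list (?r b) x)"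
      using h(2) by (intro unlabel_row_correct) auto
    have m: "unlabel_row (w ! b) (?r b) = ?r (Suc b)" "unlabel_carry (w ! b) (?r b) = unlabel ?u b n"
      using unlabel_row_map[of ?u b 0 n] unlabel_carry_map[of ?u b 0 n] by simp_all
    show ?thesis
    proof (intro conjI allI impI)
      fix x :: nat assume x: "1 \<le> x"
      have "count_list (?r (Suc b)) x + (if x = w ! b then 1 else 0) = count_list (drop b w) x"
        using * x h(3) unfolding m by simp
      then show "count_list (?r (Suc b)) x = count_list (drop (Suc b) w) x" unfolding d by (auto split: if_splits)
    qed (use * m in auto)
  qed
  have "b \<le> n \<Longrightarrow> ballot (?r b) \<and> (\<forall>x\<ge>1. count_list (?r b) x = count_list (drop b w) x)" for b
  proof (induction b)
    case 0
    have "?r 0 = w" using map_nth[of w] unfolding len by simp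
    then show ?case using bal by simp
  next
    case (Suc b)
    then show ?case using step[of b] by simp
  qed
  then show ?thesis using step[OF b] b by simp
qed

text \<open>Dots are placed in the squares with both outer labels 1. In each column the labels
  decrease weakly from a nonzero letter to the 0 of \<open>unlabel_bottom\<close>; they reach 0 just
  once, and only through such a square.\<close>

lemma row_surj:
  assumes w: "w \<in> ballot_words n"
  shows "\<exists>\<pi> \<in> involutions n. row \<pi> n n = w"
proof -
  let ?G = "unlabel ((!) w)"
  have len: "length w = n" and nz: "0 \<notin> set w" using w by (auto simp: ballot_words_def)
  \<comment> \<open>The condition is symmetric, which makes the dots form an involution.\<close>
  define X where "X a b \<longleftrightarrow> ?G a b = 1 \<and> ?G b a = 1" for a b
  have zero: "?G a (b + d) = 0" if "?G a b = 0" for a b d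
    using that by (induction d) auto
  have X0: "?G a (Suc b) = 0" "?G a b \<noteq> 0" if "X a b" for a b using that unfolding X_def by auto
  have uniq: "b = c" if "X a b" "X a c" for a b c
  proof (rule ccontr)
    assume "b \<noteq> c"
    then consider "Suc b \<le> c" | "Suc c \<le> b" by linarith
    then show False
    proof cases
      case 1 then show ?thesis using zero[OF X0(1)[OF that(1)], of "c - Suc b"] X0(2)[OF that(2)] by simp
    next
      case 2 then show ?thesis using zero[OF X0(1)[OF that(2)], of "b - Suc c"] X0(2)[OF that(1)] by simp
    qed
  qed
  have ex: "\<exists>b<n. X a b" if a: "a < n" for a
  proof -
    have "?G a 0 \<noteq> 0" using nz a len by (metis nth_mem unlabel.simps(1))
    moreover have "?G a n = 0" by (rule unlabel_bottom[OF w a])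
    moreover have "(\<And>b. b < n \<Longrightarrow> ?G a b \<noteq> 0 \<Longrightarrow> ?G a (Suc b) \<noteq> 0) \<Longrightarrow> ?G a 0 \<noteq> 0 \<Longrightarrow> c \<le> n \<Longrightarrow> ?G a c \<noteq> 0" for c
      by (induction c) (simp_all del: unlabel.simps)
    ultimately obtain b where b: "b < n" "?G a b \<noteq> 0" "?G a (Suc b) = 0" by blast
    then have "X a b" unfolding X_def by (auto split: if_splits)
    then show ?thesis using b by blast
  qed
  define P where "P a = (THE b. X a b)" for a
  have P: "X a b \<longleftrightarrow> P a = b" if "a < n" for a b
    using ex[OF that] uniq unfolding P_def by (metis (mono_tags, lifting) theI)
  have Pn: "P a < n" if "a < n" for a using ex[OF that] P[OF that] by auto
  have PP: "P (P a) = a" if "a < n" for a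
    using P[OF that, of "P a"] P[OF Pn[OF that], of a] by (simp add: X_def)
  define \<pi> where "\<pi> i = (if i \<in> {1..n} then n - P (n - i) else i)" for i
  have \<pi>in: "\<pi> \<in> involutions n"
    unfolding involutions_def
  proof (intro CollectI conjI allI impI)
    fix x show "\<pi> (\<pi> x) = x"
    proof (cases "x \<in> {1..n}")
      case True
      then have "n - x < n" by auto
      then have "P (n - x) < n" "P (P (n - x)) = n - x" using Pn PP by auto
      then show ?thesis using True by (auto simp: \<pi>_def)
    qed (auto simp: \<pi>_def)
  qed (auto simp: \<pi>_def)
  have \<pi>X: "\<pi> (Suc i) = Suc j \<longleftrightarrow> X (n - Suc i) (n - Suc j)" if ij: "Suc i \<le> n" "Suc j \<le> n" for i j
  proof -
    have "P (n - Suc i) < n" using Pn ij by simp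
    then show ?thesis using P[of "n - Suc i" "n - Suc j"] ij by (auto simp: \<pi>_def)
  qed
  have "1 \<le> i \<Longrightarrow> i \<le> n \<Longrightarrow> j \<le> n \<Longrightarrow> label \<pi> i j = ?G (n - i) (n - j)" for i j
  proof (induction "i + j" arbitrary: i j rule: less_induct)
    case less
    show ?case
    proof (cases j)
      case 0
      then show ?thesis using unlabel_bottom[OF w, of "n - i"] less.prems by simp
    next
      case (Suc j')
      obtain i' where i': "i = Suc i'" using less.prems by (cases i) auto
      define a b where "a = n - i" and "b = n - j"
      have ab: "n - i' = Suc a" "n - j' = Suc b" using less.prems Suc i' unfolding a_def b_def by auto
      have IH: "label \<pi> i j' = ?G a (Suc b)" "label \<pi> j i' = ?G b (Suc a)"
        using less.hyps[of i j'] less.hyps[of j i'] less.prems Suc i' ab unfolding a_def b_def by auto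
      have "\<pi> i = j \<longleftrightarrow> X a b" using \<pi>X[of i' j'] less.prems Suc i' unfolding a_def b_def by simp
      then have "label \<pi> i j = (if X a b then 1 else if ?G a (Suc b) = ?G b (Suc a) then bump (?G a (Suc b)) else ?G a (Suc b))"
        using IH unfolding i' Suc by simp
      \<comment> \<open>For equal labels other than 1, \<open>bump\<close> restores what truncated
        subtraction removed; unequal labels are unchanged.\<close>
      also have "\<dots> = ?G a b" unfolding X_def by (auto simp: bump_def)
      finally show ?thesis unfolding a_def b_def .
    qed
  qed
  then have "row \<pi> n n ! a = w ! a" if "a < n" for a using that by (simp add: nth_row)
  then have "row \<pi> n n = w" using len by (intro nth_equalityI) (auto simp: length_row)
  then show ?thesis using \<pi>in by blast
qed

section \<open>Diagrams with at most three columns\<close>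

text \<open>The lengths of the three columns: the letter \<open>z\<close> adds a box in row
  \<open>z\<close>, so to a column of length \<open>z - 1\<close>. Of columns of equal length the
  first is extended.\<close>

fun shape :: "nat list \<Rightarrow> nat \<times> nat \<times> nat" where
  "shape [] = (0, 0, 0)"
| "shape (z # ws) = (case shape ws of (p, q, r) \<Rightarrow>
     if z = p + 1 then (p + 1, q, r) else if z = q + 1 then (p, q + 1, r) else (p, q, r + 1))"

fun three_col :: "nat list \<Rightarrow> bool" where
  "three_col [] \<longleftrightarrow> True"
| "three_col (z # ws) \<longleftrightarrow> three_col ws \<and>
     (case shape ws of (p, q, r) \<Rightarrow> z = p + 1 \<or> z = q + 1 \<and> q < p \<or> z = r + 1 \<and> r < q)"

lemma shape_count:
  assumes "three_col ws" "shape ws = (p, q, r)"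
  shows "q \<le> p \<and> r \<le> q \<and>
    (\<forall>c\<ge>1. count_list ws c = (if c \<le> p then 1 else 0) + (if c \<le> q then 1 else 0) + (if c \<le> r then 1 else 0))"
  using assms
proof (induction ws arbitrary: p q r)
  case Nil
  then show ?case by auto
next
  case (Cons z ws)
  obtain p' q' r' where s: "shape ws = (p', q', r')" by (cases "shape ws") auto
  then show ?case using Cons.IH[OF _ s] Cons.prems by (auto split: if_splits)
qed

text \<open>The letters 1 count the boxes of the first row, hence the columns.\<close>

lemma three_col_iff: "three_col ws \<longleftrightarrow> ballot ws \<and> 0 \<notin> set ws \<and> count_list ws 1 \<le> 3"
proof (induction ws)
  case Nil
  then show ?case by simp
next
  case (Cons z ws)
  show ?case
  proof (cases "three_col ws")
    case False
    then show ?thesis using Cons by (auto split: if_splits)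
  next
    case True
    obtain p q r where s: "shape ws = (p, q, r)" by (cases "shape ws") auto
    have o: "q \<le> p" "r \<le> q"
      and c: "1 \<le> c \<Longrightarrow> count_list ws c = (if c \<le> p then 1 else 0) + (if c \<le> q then 1 else 0) + (if c \<le> r then 1 else 0)" for c
      using shape_count[OF True s] by blast+
    consider "z = 0" | "z = 1" | "2 \<le> z" by linarith
    then show ?thesis
    proof cases
      case 3
      have 1: "1 \<le> z - 1" "1 \<le> z" using 3 by auto
      show ?thesis using 3 Cons True s o c[OF 1(1)] c[OF 1(2)] by (auto split: if_splits)
    qed (use Cons True s o c[of 1] in \<open>auto split: if_splits\<close>)
  qed
qed

text \<open>As words are written backwards, \<open>y\<close> belongs to the later position;
  \<open>y \<le> x\<close> records an ascent, that is, two boxes in different columns, the left one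
  first.\<close>

fun pair_desc :: "nat list \<Rightarrow> bool" where
  "pair_desc [] \<longleftrightarrow> True"
| "pair_desc [x] \<longleftrightarrow> False"
| "pair_desc (y # x # ws) \<longleftrightarrow> y \<le> x \<and> pair_desc ws"

definition pair_words :: "nat \<Rightarrow> nat list set" where
  "pair_words m = {ws. length ws = 2 * m \<and> three_col ws \<and> pair_desc ws}"

definition pair_ext :: "nat list \<Rightarrow> (nat \<times> nat) set" where
  "pair_ext ws = {(y, x). three_col (y # x # ws) \<and> y \<le> x}"

text \<open>The number of integers from \<open>max 0 (h - (q - r))\<close> to
  \<open>min (p - q) h\<close>, the outer \<open>max 0\<close> accounting for an empty range. For
  \<open>r \<le> q \<le> p\<close> it vanishes at \<open>h = - 1\<close>.\<close>

definition weight :: "int \<Rightarrow> nat list \<Rightarrow> int" where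
  "weight h ws = (case shape ws of (p, q, r) \<Rightarrow>
     max 0 (min (int p - int q) h - max 0 (h - (int q - int r)) + 1))"

text \<open>The three options omit column 3, 2 or 1. The condition \<open>y \<le> x\<close> fixes
  the order: the left column is extended first.\<close>

lemma pair_ext_eq:
  assumes "three_col ws" "shape ws = (p, q, r)"
  shows "pair_ext ws = {(q + 1, p + 1)} \<union> (if r < q then {(r + 1, p + 1)} else {}) \<union> (if q < p then {(r + 1, q + 1)} else {})"
proof -
  have o: "q \<le> p" "r \<le> q" using shape_count[OF assms] by auto
  have "three_col (y # x # ws) \<and> y \<le> x \<longleftrightarrow>
    y = q + 1 \<and> x = p + 1 \<or> r < q \<and> y = r + 1 \<and> x = p + 1 \<or> q < p \<and> y = r + 1 \<and> x = q + 1" for x y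
  proof -
    consider "x = p + 1" | "x = q + 1" "q < p" | "x = r + 1" "r < q" | "\<not> three_col (x # ws)"
      using assms by auto
    then show ?thesis
    proof cases
      case 1
      then show ?thesis using assms o by auto
    next
      case 2
      then show ?thesis using assms o by auto
    next
      case 3
      then show ?thesis using assms o by auto
    next
      case 4
      then show ?thesis using assms o by auto
    qed
  qed
  then show ?thesis unfolding pair_ext_def by (auto split: if_splits)
qed

text \<open>Omitting one column is the Pieri rule for the exterior square of the natural
  representation of SL3, which restricts to SL2 with constituents of dimension 2 and 1. Tensoring
  with these changes the height by -1, 0 or 1. The proof verifies the resulting identity by cases on
  the corners of the shape.\<close>

lemma weight_pair_ext:
  assumes "three_col ws" "0 \<le> h"
  shows "(\<Sum>(y, x)\<in>pair_ext ws. weight h (y # x # ws)) = weight (h - 1) ws + weight h ws + weight (h + 1) ws"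
proof -
  obtain p q r where s: "shape ws = (p, q, r)" by (cases "shape ws") auto
  have o: "q \<le> p" "r \<le> q" using shape_count[OF assms(1) s] by auto
  obtain x y where xy: "p = q + x" "q = r + y" using o le_Suc_ex by metis
  show ?thesis unfolding pair_ext_eq[OF assms(1) s] using s xy assms(2)
    by (cases "r < q"; cases "q < p") (auto simp: weight_def max_def min_def)
qed

lemma pair_words_Suc:
  "pair_words (Suc m) = (\<lambda>(ws, y, x). y # x # ws) ` (SIGMA ws:pair_words m. pair_ext ws)"
proof (intro equalityI subsetI)
  fix w assume w: "w \<in> pair_words (Suc m)"
  then obtain y x ws where "w = y # x # ws" by (auto simp: pair_words_def length_Suc_conv numeral_2_eq_2)
  then show "w \<in> (\<lambda>(ws, y, x). y # x # ws) ` (SIGMA ws:pair_words m. pair_ext ws)"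
    using w by (intro image_eqI[of _ _ "(ws, y, x)"]) (auto simp: pair_words_def pair_ext_def)
qed (auto simp: pair_words_def pair_ext_def)

lemma finite_pair_ext: "ws \<in> pair_words m \<Longrightarrow> finite (pair_ext ws)"
  by (cases "shape ws") (auto simp: pair_ext_eq pair_words_def)

lemma pair_words_0: "pair_words 0 = {[]}"
  by (auto simp: pair_words_def)

lemma finite_pair_words: "finite (pair_words m)"
proof (induction m)
  case (Suc m)
  then show ?case unfolding pair_words_Suc by (intro finite_imageI finite_SigmaI finite_pair_ext)
qed (simp add: pair_words_0)

lemma sum_weight_Suc:
  assumes "0 \<le> h"
  shows "(\<Sum>w\<in>pair_words (Suc m). weight h w) =
    (\<Sum>w\<in>pair_words m. weight (h - 1) w) + (\<Sum>w\<in>pair_words m. weight h w) + (\<Sum>w\<in>pair_words m. weight (h + 1) w)"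
proof -
  have "(\<Sum>w\<in>pair_words (Suc m). weight h w) = (\<Sum>(ws, y, x)\<in>(SIGMA ws:pair_words m. pair_ext ws). weight h (y # x # ws))"
    unfolding pair_words_Suc by (subst sum.reindex) (auto simp: inj_on_def case_prod_unfold)
  also have "\<dots> = (\<Sum>ws\<in>pair_words m. \<Sum>(y, x)\<in>pair_ext ws. weight h (y # x # ws))"
    using finite_pair_words finite_pair_ext by (subst sum.Sigma) (auto simp: case_prod_unfold)
  also have "\<dots> = (\<Sum>ws\<in>pair_words m. weight (h - 1) ws + weight h ws + weight (h + 1) ws)"
    by (rule sum.cong) (auto simp: pair_words_def intro: weight_pair_ext assms)
  finally show ?thesis by (simp add: sum.distrib)
qed

section \<open>Prefixes of Motzkin paths\<close>

definition motzkin_prefixes :: "int \<Rightarrow> nat \<Rightarrow> step list set" where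
  "motzkin_prefixes h m = {p. length p = m \<and> (\<forall>k\<le>m. height p k \<ge> 0) \<and> height p m = h}"

lemma height_snoc:
  "k \<le> length p \<Longrightarrow> height (p @ [s]) k = height p k"
  "height (p @ [s]) (Suc (length p)) = height p (length p) + rise s"
  by (auto simp: height_def)

lemma motzkin_prefixes_neg: "h < 0 \<Longrightarrow> motzkin_prefixes h m = {}"
  by (auto simp: motzkin_prefixes_def)

lemma motzkin_prefixes_0: "motzkin_prefixes h 0 = (if h = 0 then {[]} else {})"
  by (auto simp: motzkin_prefixes_def height_def)

lemma motzkin_prefixes_Suc:
  assumes "0 \<le> h"
  shows "motzkin_prefixes h (Suc m) = (\<lambda>p. p @ [Up]) ` motzkin_prefixes (h - 1) m \<union>
    (\<lambda>p. p @ [Horiz]) ` motzkin_prefixes h m \<union> (\<lambda>p. p @ [Down]) ` motzkin_prefixes (h + 1) m"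
    (is "?L = ?U \<union> ?H \<union> ?D")
proof -
  have iff: "p @ [s] \<in> ?L \<longleftrightarrow> p \<in> motzkin_prefixes (h - rise s) m" for p s
  proof (cases "length p = m")
    case True
    then show ?thesis using assms height_snoc(1)[of _ p s] height_snoc(2)[of p s]
      by (auto simp: motzkin_prefixes_def le_Suc_eq)
  qed (auto simp: motzkin_prefixes_def)
  have "w \<in> ?L \<longleftrightarrow> w \<in> ?U \<union> ?H \<union> ?D" for w
  proof (cases w rule: rev_cases)
    case Nil
    then show ?thesis by (auto simp: motzkin_prefixes_def)
  next
    case (snoc p s)
    then show ?thesis using iff[of p s] by (cases s) auto
  qed
  then show ?thesis by blast
qed

lemma finite_motzkin_prefixes: "finite (motzkin_prefixes h m)"
proof (induction m arbitrary: h)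
  case (Suc m)
  then show ?case by (cases "0 \<le> h") (auto simp: motzkin_prefixes_Suc motzkin_prefixes_neg)
qed (simp add: motzkin_prefixes_0)

lemma card_motzkin_prefixes_Suc:
  assumes "0 \<le> h"
  shows "card (motzkin_prefixes h (Suc m)) =
    card (motzkin_prefixes (h - 1) m) + card (motzkin_prefixes h m) + card (motzkin_prefixes (h + 1) m)"
proof -
  have c: "card ((\<lambda>p. p @ [s]) ` A) = card A" for s :: step and A by (simp add: card_image inj_on_def)
  show ?thesis unfolding motzkin_prefixes_Suc[OF assms]
    by (subst card_Un_disjoint, auto simp: finite_motzkin_prefixes)
      (subst card_Un_disjoint, auto simp: finite_motzkin_prefixes c)
qed

text \<open>Each shape \<open>(p, q, r)\<close> is weighted by the number of \<open>(a, b)\<close> with \<open>a \<le> p - q\<close>, \<open>b \<le> q - r\<close>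
  and \<open>a + b = h\<close>. This is the multiplicity of the irreducible representation of dimension \<open>h + 1\<close>
  when that of highest weight \<open>(p, q, r)\<close> is restricted from \<open>SL\<^sub>3\<close> to \<open>SL\<^sub>2\<close>, which explains
  why the weighted sums obey the recurrence for heights of Motzkin paths.\<close>

lemma sum_weight_eq: "0 \<le> h \<Longrightarrow> (\<Sum>w\<in>pair_words m. weight h w) = int (card (motzkin_prefixes h m))"
proof (induction m arbitrary: h)
  case 0
  then show ?case by (auto simp: pair_words_0 motzkin_prefixes_0 weight_def)
next
  case (Suc m)
  have "(\<Sum>w\<in>pair_words m. weight (h - 1) w) = int (card (motzkin_prefixes (h - 1) m))"
  proof (cases "h = 0")
    case True
    \<comment> \<open>At height 0 the recurrence reaches \<open>h = - 1\<close>, where the weight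
      vanishes and there are no prefixes.\<close>
    have "(\<Sum>w\<in>pair_words m. weight (- 1) w) = 0"
      by (rule sum.neutral) (auto simp: weight_def pair_words_def dest!: shape_count split: prod.split)
    then show ?thesis using True by (simp add: motzkin_prefixes_neg)
  next
    case False
    then show ?thesis using Suc by simp
  qed
  then show ?case unfolding sum_weight_Suc[OF Suc.prems] card_motzkin_prefixes_Suc[OF Suc.prems] using Suc by simp
qed

text \<open>The last single box can be added in one way, plus one if \<open>q < p\<close>, plus one
  if \<open>r < q\<close>, which is \<open>weight 0 + weight 1\<close>. This matches the heights 0
  and 1 from which a level or a falling step ends at 0.\<close>

lemma card_odd_words:
  "card {w. length w = 2 * m + 1 \<and> three_col w \<and> pair_desc (tl w)} = motzkin (m + 1)"
proof -
  let ?E = "\<lambda>ws. {z. three_col (z # ws)}"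
  have E: "finite (?E ws)" "int (card (?E ws)) = weight 0 ws + weight 1 ws" if "ws \<in> pair_words m" for ws
  proof -
    obtain p q r where s: "shape ws = (p, q, r)" by (cases "shape ws") auto
    have t: "three_col ws" using that by (simp add: pair_words_def)
    have o: "q \<le> p" "r \<le> q" using shape_count[OF t s] by auto
    have e: "?E ws = {p + 1} \<union> (if q < p then {q + 1} else {}) \<union> (if r < q then {r + 1} else {})"
      using t s by auto
    show "finite (?E ws)" unfolding e by simp
    show "int (card (?E ws)) = weight 0 ws + weight 1 ws"
      unfolding e using o s by (cases "q < p"; cases "r < q") (auto simp: weight_def max_def min_def)
  qed
  have "{w. length w = 2 * m + 1 \<and> three_col w \<and> pair_desc (tl w)} =
    (\<lambda>(ws, z). z # ws) ` (SIGMA ws:pair_words m. ?E ws)" (is "?L = ?R")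
  proof (intro equalityI subsetI)
    fix w assume w: "w \<in> ?L"
    then obtain z ws where "w = z # ws" by (cases w) auto
    then show "w \<in> ?R" using w by (intro image_eqI[of _ _ "(ws, z)"]) (auto simp: pair_words_def)
  qed (auto simp: pair_words_def)
  then have "card ?L = card (SIGMA ws:pair_words m. ?E ws)"
    by (simp add: card_image inj_on_def case_prod_unfold prod_eq_iff)
  also have "\<dots> = (\<Sum>ws\<in>pair_words m. card (?E ws))"
    using finite_pair_words E(1) by (intro card_SigmaI) auto
  finally have "int (card ?L) = (\<Sum>ws\<in>pair_words m. weight 0 ws + weight 1 ws)" using E(2) by simp
  also have "\<dots> = int (card (motzkin_prefixes 0 (Suc m)))"
    by (simp add: sum.distrib sum_weight_eq card_motzkin_prefixes_Suc motzkin_prefixes_neg)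
  finally show ?thesis by (simp add: motzkin_def motzkin_paths_def motzkin_prefixes_def)
qed

section \<open>Counting the involutions by words\<close>

lemma invol_alt_eq: "invol_alt n m = {\<pi> \<in> involutions n. alternating m \<pi>}"
  using permutes_involution_iff[of _ "{1..n}"] unfolding invol_alt_def involutions_def by blast

text \<open>Schensted's theorem for length four: an occurrence of 1234 is a chain of four dots in
  the full square.\<close>

lemma contains_1234_iff_count:
  assumes \<pi>: "\<pi> \<in> involutions n"
  shows "contains_pattern n \<pi> [1, 2, 3, 4] \<longleftrightarrow> 4 \<le> count_list (row \<pi> n n) 1"
proof -
  interpret involution \<pi> using \<pi> by (rule involution_locale)
  have "contains_pattern n \<pi> [1, 2, 3, 4] \<longleftrightarrow> chain (Suc (Suc (Suc (Suc 0)))) n n"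
    unfolding contains_1234
  proof
    assume "\<exists>i j k l. 1 \<le> i \<and> i < j \<and> j < k \<and> k < l \<and> l \<le> n \<and> \<pi> i < \<pi> j \<and> \<pi> j < \<pi> k \<and> \<pi> k < \<pi> l"
    then obtain i j k l where h: "1 \<le> i" "i < j" "j < k" "k < l" "l \<le> n" "\<pi> i < \<pi> j" "\<pi> j < \<pi> k" "\<pi> k < \<pi> l"
      by blast
    then have 1: "chain (Suc 0) (j - 1) (\<pi> j - 1)" by auto
    have 2: "chain (Suc (Suc 0)) (k - 1) (\<pi> k - 1)"
      unfolding chain.simps(2)[of "Suc 0"] using h 1 by (intro exI[of _ j]) auto
    have 3: "chain (Suc (Suc (Suc 0))) (l - 1) (\<pi> l - 1)"
      unfolding chain.simps(2)[of "Suc (Suc 0)"] using h 2 by (intro exI[of _ k]) auto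
    have "\<pi> l \<in> {1..n}" using h by (intro involutions_in[OF \<pi>]) auto
    then show "chain (Suc (Suc (Suc (Suc 0)))) n n"
      unfolding chain.simps(2)[of "Suc (Suc (Suc 0))"] using h 3 by (intro exI[of _ l]) auto
  next
    assume "chain (Suc (Suc (Suc (Suc 0)))) n n"
    then obtain l where l: "1 \<le> l" "l \<le> n" "chain (Suc (Suc (Suc 0))) (l - 1) (\<pi> l - 1)"
      unfolding chain.simps(2)[of "Suc (Suc (Suc 0))"] by blast
    then obtain k where k: "1 \<le> k" "k \<le> l - 1" "\<pi> k \<le> \<pi> l - 1" "chain (Suc (Suc 0)) (k - 1) (\<pi> k - 1)"
      unfolding chain.simps(2)[of "Suc (Suc 0)"] by blast
    then obtain j where j: "1 \<le> j" "j \<le> k - 1" "\<pi> j \<le> \<pi> k - 1" "chain (Suc 0) (j - 1) (\<pi> j - 1)"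
      unfolding chain.simps(2)[of "Suc 0"] by blast
    then obtain i where i: "1 \<le> i" "i \<le> j - 1" "\<pi> i \<le> \<pi> j - 1"
      unfolding chain.simps(2)[of 0] by blast
    have p: "1 \<le> \<pi> j" "1 \<le> \<pi> k" "1 \<le> \<pi> l" using pos i j k l by auto
    have "1 \<le> i \<and> i < j \<and> j < k \<and> k < l \<and> l \<le> n \<and> \<pi> i < \<pi> j \<and> \<pi> j < \<pi> k \<and> \<pi> k < \<pi> l"
      using i(2,3) j(2,3) k(2,3) p l(2) i(1) j(1) k(1) l(1) by linarith
    then show "\<exists>i j k l. 1 \<le> i \<and> i < j \<and> j < k \<and> k < l \<and> l \<le> n \<and> \<pi> i < \<pi> j \<and> \<pi> j < \<pi> k \<and> \<pi> k < \<pi> l"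
      by blast
  qed
  then show ?thesis unfolding chain_iff_count by (simp add: numeral_eq_Suc)
qed

lemma pair_desc_row:
  "pair_desc (row \<pi> (2 * m) n) \<longleftrightarrow> (\<forall>t<m. label \<pi> (Suc (Suc (2 * t))) n \<le> label \<pi> (Suc (2 * t)) n)"
  by (induction m) (auto simp: less_Suc_eq simp del: label.simps)

text \<open>Without 1234, ascents at the odd positions force descents in between: an ascent at an
  even position would join its two neighbouring ascents to a 1234.\<close>

lemma alternating_iff_ascents:
  assumes av: "\<not> contains_pattern (2 * m + 1) \<pi> [1, 2, 3, 4]"
  shows "alternating (2 * m) \<pi> \<longleftrightarrow> (\<forall>t<m. \<pi> (Suc (2 * t)) < \<pi> (Suc (Suc (2 * t))))"
proof
  assume a: "alternating (2 * m) \<pi>"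
  show "\<forall>t<m. \<pi> (Suc (2 * t)) < \<pi> (Suc (Suc (2 * t)))"
  proof (intro allI impI)
    fix t assume "t < m"
    then show "\<pi> (Suc (2 * t)) < \<pi> (Suc (Suc (2 * t)))"
      using a[unfolded alternating_def, rule_format, of "Suc (2 * t)"] by simp
  qed
next
  assume asc: "\<forall>t<m. \<pi> (Suc (2 * t)) < \<pi> (Suc (Suc (2 * t)))"
  show "alternating (2 * m) \<pi>" unfolding alternating_def
  proof (intro allI impI)
    fix i assume i: "1 \<le> i \<and> i + 1 \<le> 2 * m"
    show "\<pi> i < \<pi> (i + 1) \<longleftrightarrow> odd i"
    proof (cases "odd i")
      case True
      then obtain t where "i = Suc (2 * t)" by (auto elim: oddE)
      then show ?thesis using asc i by auto
    next
      case False
      then obtain s where "i = 2 * s" by (auto elim: evenE)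
      moreover then obtain t where "s = Suc t" using i by (cases s) auto
      ultimately have it: "i = Suc (Suc (2 * t))" by simp
      then have t: "t < m" "Suc t < m" using i by auto
      have "\<not> \<pi> i < \<pi> (i + 1)"
      proof
        assume "\<pi> i < \<pi> (i + 1)"
        then have "contains_pattern (2 * m + 1) \<pi> [1, 2, 3, 4]" unfolding contains_1234
          using asc[rule_format, OF t(1)] asc[rule_format, OF t(2)] it t
          by (intro exI[of _ "Suc (2 * t)"] exI[of _ i] exI[of _ "i + 1"] exI[of _ "i + 2"]) simp
        then show False using av by simp
      qed
      then show ?thesis using False by simp
    qed
  qed
qed

lemma card_invol_alt_1234:
  "card {\<pi> \<in> invol_alt (2 * m + 1) (2 * m). \<not> contains_pattern (2 * m + 1) \<pi> [1, 2, 3, 4]} = motzkin (m + 1)"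
proof -
  let ?n = "2 * m + 1"
  let ?K = "{\<pi> \<in> invol_alt ?n (2 * m). \<not> contains_pattern ?n \<pi> [1, 2, 3, 4]}"
  let ?W = "{w. length w = ?n \<and> three_col w \<and> pair_desc (tl w)}"
  have K: "\<pi> \<in> ?K \<longleftrightarrow> row \<pi> ?n ?n \<in> ?W" if \<pi>: "\<pi> \<in> involutions ?n" for \<pi>
  proof -
    interpret involution \<pi> using \<pi> by (rule involution_locale)
    have "length (row \<pi> ?n ?n) = ?n" "ballot (row \<pi> ?n ?n)" "0 \<notin> set (row \<pi> ?n ?n)"
      using row_in_ballot_words[OF \<pi>] unfolding ballot_words_def by blast+
    then have "row \<pi> ?n ?n \<in> ?W \<longleftrightarrow> \<not> contains_pattern ?n \<pi> [1, 2, 3, 4] \<and> pair_desc (tl (row \<pi> ?n ?n))"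
      unfolding three_col_iff contains_1234_iff_count[OF \<pi>] by auto
    \<comment> \<open>Words are written backwards, so \<open>tl\<close> removes the letter of the
      last position, which is not subject to alternation.\<close>
    also have "tl (row \<pi> ?n ?n) = row \<pi> (2 * m) ?n" by simp
    also have "pair_desc (row \<pi> (2 * m) ?n) \<longleftrightarrow> (\<forall>t<m. \<pi> (Suc (2 * t)) < \<pi> (Suc (Suc (2 * t))))"
      unfolding pair_desc_row
    proof (intro all_cong1 imp_cong refl)
      fix t assume "t < m"
      then have "Suc (2 * t) \<in> {1..?n}" "Suc (Suc (2 * t)) \<in> {1..?n}" by auto
      then have "\<pi> (Suc (2 * t)) \<in> {1..?n}" "\<pi> (Suc (Suc (2 * t))) \<in> {1..?n}"
        using involutions_in[OF \<pi>] by blast+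
      then show "label \<pi> (Suc (Suc (2 * t))) ?n \<le> label \<pi> (Suc (2 * t)) ?n \<longleftrightarrow>
          \<pi> (Suc (2 * t)) < \<pi> (Suc (Suc (2 * t)))"
        by (intro label_ascent_iff) simp_all
    qed
    finally show ?thesis using \<pi> alternating_iff_ascents unfolding invol_alt_eq by blast
  qed
  have inj: "inj_on (\<lambda>\<pi>. row \<pi> ?n ?n) ?K" by (rule inj_on_subset[OF row_inj]) (auto simp: invol_alt_eq)
  have "(\<lambda>\<pi>. row \<pi> ?n ?n) ` ?K = ?W"
  proof (intro equalityI subsetI)
    fix w assume "w \<in> (\<lambda>\<pi>. row \<pi> ?n ?n) ` ?K"
    then obtain \<pi> where \<pi>: "\<pi> \<in> ?K" "w = row \<pi> ?n ?n" by blast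
    then have "\<pi> \<in> involutions ?n" by (simp add: invol_alt_eq)
    from K[OF this] show "w \<in> ?W" using \<pi> by (simp only:)
  next
    fix w assume w: "w \<in> ?W"
    then have "w \<in> ballot_words ?n" unfolding ballot_words_def three_col_iff by blast
    from row_surj[OF this] obtain \<pi> where \<pi>: "\<pi> \<in> involutions ?n" "row \<pi> ?n ?n = w" by blast
    from K[OF \<pi>(1)] have "\<pi> \<in> ?K" using \<pi>(2) w by (simp only:)
    with \<pi>(2) show "w \<in> (\<lambda>\<pi>. row \<pi> ?n ?n) ` ?K" by (rule image_eqI[OF sym])
  qed
  then have "card ?K = card ?W" using card_image[OF inj] by (simp only:)
  then show ?thesis unfolding card_odd_words .
qed

lemma card_RAI_2134_motzkin: "card (RAI_av (2 * n + 1) [2, 1, 3, 4]) = motzkin n"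
proof (cases n)
  case 0
  \<comment> \<open>Length 1 is too short for the outer cycle and is treated directly.\<close>
  have "RAI_av 1 [2, 1, 3, 4] = {id}"
    unfolding RAI_av_def RAI_def reverse_alternating_def contains_2134 by auto
  moreover have "motzkin_paths 0 = {[]}" by (auto simp: motzkin_paths_def height_def)
  ultimately show ?thesis using 0 by (simp add: motzkin_def)
next
  case (Suc m)
  then have "2 * n + 1 = (2 * m + 1) + 2" by simp
  then show ?thesis
    using card_RAI_2134[of "2 * m + 1"] card_invol_alt_1234_2134[of "2 * m"] card_invol_alt_1234[of m] Suc by simp
qed

theorem theorem7p2:
  fixes n :: nat
  shows "card (AI_av (2 * n + 1) [1, 2, 4, 3]) = card (AI_av (2 * n + 1) [2, 1, 4, 3])
    \<and> card (AI_av (2 * n + 1) [2, 1, 4, 3]) = card (RAI_av (2 * n + 1) [2, 1, 4, 3])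
    \<and> card (RAI_av (2 * n + 1) [2, 1, 4, 3]) = card (RAI_av (2 * n + 1) [2, 1, 3, 4])
    \<and> card (RAI_av (2 * n + 1) [2, 1, 3, 4]) = motzkin n"
  using card_AI_1243_2143[of "2 * n + 1"] card_RAI_2134_motzkin[of n]
    card_AI_RAI[of "2 * n + 1" "[1, 2, 4, 3]" "[2, 1, 3, 4]"]
    card_AI_RAI[of "2 * n + 1" "[2, 1, 4, 3]" "[2, 1, 4, 3]"] by simp

end
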